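(* Let $D$ be a $k$-partite tournament with $k$-partition $(V_1,\ldots,V_k)$ and ordered strong components $Q_1,\ldots,Q_s$ for some integers $k\ge 2$ and $s\ge 2$, and let $Q_t$ be the last nontrivial component of $D$, with $\kappa(Q_t)=4$ and $t<s$. Assume that the partite sets are labeled so that $V_i\cap V(Q_t)=U_i^{(t)}\cup U_{i+2}^{(t)}$ for $i=1,2$, where $U_1^{(t)},U_2^{(t)},U_3^{(t)},U_4^{(t)}$ are the sets of imprimitivity of $Q_t$. Let $r$ be the head completing index of $D$, and let $A_1=V_1\cap\bigcup_{i=r+1}^{t}V(Q_i)$ and $A_2=V_2\cap\bigcup_{i=r+1}^{t}V(Q_i)$. Let $G_4$ and $G_5$ be the graphs on $V(D_{1\sim t})$ defined in the context. Then there exists a positive integer $N$ such that, for any $m\ge N$, $C^m(D)$ is isomorphic to - $K[D_{1\sim t}]\cup I[D_{t+1\sim s}]$, if $V(D_{t+1\sim s})\not\subseteq V_1\cup V_2$; - $\bigl(K[D_{1\sim r}]\vee(K[A_1]\cup K[A_2])\bigr)\cup I[D_{t+1\sim s}]$, if $V(D_{t+1\sim s})\subseteq V_1\cup V_2$, $V(D_{t+1\sim s})\cap V_1\ne\emptyset$, and $V(D_{t+1\sim s})\cap V_2\neq\emptyset$; - $G_4\cup I[D_{t+1\sim s}]$ for even $m$ and $G_5\cup I[D_{t+1\sim s}]$ for odd $m$, if $V(D_{t+1\sim s})\subseteq V_1$; - $G_5\cup I[D_{t+1\sim s}]$ for even $m$ and $G_4\cup I[D_{t+1\sim s}]$ for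 odd $m$, if $V(D_{t+1\sim s})\subseteq V_2$.
   Context: All digraphs are finite with simple underlying graph. For a positive integer $m$, the $m$-step competition graph $C^m(D)$ of a digraph $D$ is the simple graph with vertex set $V(D)$ in which two distinct vertices $u,v$ are adjacent iff there is a vertex $w$ such that there are directed walks of length exactly $m$ from $u$ to $w$ and from $v$ to $w$. A $k$-partite tournament is an orientation of a complete $k$-partite graph; its $k$-partition $(V_1,\dots,V_k)$ consists of its (nonempty) partite sets. Ordered strong components of $D$ are its strong components arranged as $Q_1,\ldots,Q_s$ so that there is no arc from $Q_i$ to $Q_j$ whenever $i>j$. A strong component is trivial if it has exactly one vertex and nontrivial otherwise. The last nontrivial component is the nontrivial $Q_t$ such that $Q_i$ is trivial for every $t<i\le s$. $D_{\alpha\sim\beta}$ denotes the subdigraph induced by $\bigcup_{i=\alpha}^{\beta}V(Q_i)$ if $\alpha\le\beta$, and is ignored (empty) if $\alpha>\beta$. For a nontrivial strongly connected digraph $Q$, the index of imprimitivity $\kappa(Q)$ is the greatest common divisor of the lengths of its closed directed walks. The sets of imprimitivity of $Q$ are the nonempty sets $U_1,\dots,U_{\kappa(Q)}$ partitioning $V(Q)$ such that each arc of $Q$ goes from $U_i$ to $U_{i+1}$ for some $i$ (with $U_{\kappa(Q)+1}=U_1$); those of $Q_t$ are written $U_i^{(t)}$. It is known that if $\kappa(Q_t)=4$ then $Q_t$ is a bipartite tournament each of whose two partite sets is a union of two sets of imprimitivity, so the labeling assumed in the claim is always possible. A partite set of $Q_i$ is a nonempty intersection of $V(Q_i)$ with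 a partite set of $D$. A vertex set $X$ is partite-related to a vertex set $Y$ if $X$ and $Y$ are both contained in one partite set of $D$. Head completing index of $D$: if there is an integer $r$ with $1\le r<t$ such that some partite set of $Q_r$ is not partite-related to any partite set of $Q_t$, the head completing index is the largest such $r$; otherwise it equals $0$. For vertex-disjoint graphs, $\cup$ denotes disjoint union and $\vee$ denotes join (the union together with all edges between the two graphs). For a vertex set $Z$, $K[Z]$ and $I[Z]$ are the complete graph and the edgeless graph on $Z$; for a digraph $H$, $K[H]=K[V(H)]$ and $I[H]=I[V(H)]$. Definition of $G_4,G_5$: let $W_1=V(D_{1\sim r})$, $W_2=A_1\setminus V(Q_t)$, $W_3=A_2\setminus V(Q_t)$, $W_4=U_1^{(t)}$, $W_5=U_3^{(t)}$, $W_6=U_2^{(t)}$, $W_7=U_4^{(t)}$ ($W_1,W_2,W_3$ may be empty). Both graphs have vertex set $W_1\cup\cdots\cup W_7$, and each $W_a$ is a clique in both. For $a\neq b$, either all edges or no edges between $W_a$ and $W_b$ are present. In $G_4$ all edges between $W_a$ and $W_b$ are present exactly for the pairs $\{a,b\}$ in $\{1,2\},\{1,3\},\{1,4\},\{1,5\},\{1,6\},\{1,7\},\{2,4\},\{2,5\},\{3,6\},\{3,7\},\{4,5\}$. In $G_5$ they are present exactly for the pairs $\{1,2\},\{1,3\},\{1,4\},\{1,5\},\{1,6\},\{1,7\},\{2,4\},\{2,5\},\{3,6\},\{3,7\},\{6,7\}$. *)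

theory Defs
  imports "Graph_Theory.Graph_Theory" "HOL-Library.Disjoint_Sets"
begin

text \<open>
  Digraphs without parallel arcs are \<open>pair_digraph\<close>s.  Following Graph_Theory, a simple graph is
  a symmetric loop-free digraph whose arcs are pairs of vertices, and graph isomorphism is
  \<^const>\<open>digraph_iso\<close>.
\<close>

type_synonym 'a sgraph = "('a, 'a \<times> 'a) pre_digraph"

definition m_step_competition_graph :: "nat \<Rightarrow> ('a, 'b) pre_digraph \<Rightarrow> 'a sgraph" where
  "m_step_competition_graph m G = with_proj
     \<lparr> pverts = verts G,
       parcs = {(u, v). u \<in> verts G \<and> v \<in> verts G \<and> u \<noteq> v \<and>
         (\<exists>w p q. pre_digraph.awalk G u p w \<and> length p = m \<and>
                  pre_digraph.awalk G v q w \<and> length q = m)} \<rparr>"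

definition complete_on :: "'a set \<Rightarrow> 'a sgraph" where
  "complete_on Z = with_proj \<lparr> pverts = Z, parcs = {(u, v). u \<in> Z \<and> v \<in> Z \<and> u \<noteq> v} \<rparr>"

definition edgeless_on :: "'a set \<Rightarrow> 'a sgraph" where
  "edgeless_on Z = with_proj \<lparr> pverts = Z, parcs = {} \<rparr>"

text \<open>
  The join of vertex-disjoint graphs; their disjoint union is \<^const>\<open>union\<close> from Graph_Theory.
\<close>
definition join :: "'a sgraph \<Rightarrow> 'a sgraph \<Rightarrow> 'a sgraph" where
  "join G H = with_proj
     \<lparr> pverts = verts G \<union> verts H,
       parcs = arcs G \<union> arcs H \<union> verts G \<times> verts H \<union> verts H \<times> verts G \<rparr>"

text \<open>
  The graph on \<open>W 1 \<union> \<dots> \<union> W n\<close> in which every \<open>W a\<close> is a clique and, for \<open>a \<noteq> b\<close>, all edges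
  between \<open>W a\<close> and \<open>W b\<close> are present if \<open>{a, b} \<in> P\<close>, and none otherwise.
\<close>
definition clique_blowup :: "nat \<Rightarrow> (nat \<Rightarrow> 'a set) \<Rightarrow> nat set set \<Rightarrow> 'a sgraph" where
  "clique_blowup n W P = with_proj
     \<lparr> pverts = (\<Union>a\<in>{1..n}. W a),
       parcs = {(u, v). u \<noteq> v \<and>
         (\<exists>a\<in>{1..n}. \<exists>b\<in>{1..n}. u \<in> W a \<and> v \<in> W b \<and> (a = b \<or> {a, b} \<in> P))} \<rparr>"

definition partite_tournament :: "'a pair_pre_digraph \<Rightarrow> nat \<Rightarrow> (nat \<Rightarrow> 'a set) \<Rightarrow> bool" where
  "partite_tournament D k V \<longleftrightarrow>
     pair_digraph D \<and>
     (\<forall>i\<in>{1..k}. V i \<noteq> {}) \<and>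
     disjoint_family_on V {1..k} \<and>
     (\<Union>i\<in>{1..k}. V i) = pverts D \<and>
     (\<forall>i\<in>{1..k}. \<forall>u\<in>V i. \<forall>v\<in>V i. (u, v) \<notin> parcs D) \<and>
     (\<forall>i\<in>{1..k}. \<forall>j\<in>{1..k}. i \<noteq> j \<longrightarrow>
        (\<forall>u\<in>V i. \<forall>v\<in>V j. (u, v) \<in> parcs D \<longleftrightarrow> (v, u) \<notin> parcs D))"

definition ordered_strong_components ::
    "('a, 'b) pre_digraph \<Rightarrow> nat \<Rightarrow> (nat \<Rightarrow> ('a, 'b) pre_digraph) \<Rightarrow> bool" where
  "ordered_strong_components G s Q \<longleftrightarrow>
     bij_betw Q {1..s} (pre_digraph.sccs G) \<and>
     (\<forall>i\<in>{1..s}. \<forall>j\<in>{1..s}. i > j \<longrightarrow>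
        (\<forall>u\<in>verts (Q i). \<forall>v\<in>verts (Q j). \<not> u \<rightarrow>\<^bsub>G\<^esub> v))"

definition trivial_component :: "('a, 'b) pre_digraph \<Rightarrow> bool" where
  "trivial_component H \<longleftrightarrow> card (verts H) = 1"

definition last_nontrivial_component ::
    "nat \<Rightarrow> (nat \<Rightarrow> ('a, 'b) pre_digraph) \<Rightarrow> nat \<Rightarrow> bool" where
  "last_nontrivial_component s Q t \<longleftrightarrow>
     t \<in> {1..s} \<and> \<not> trivial_component (Q t) \<and> (\<forall>i. t < i \<and> i \<le> s \<longrightarrow> trivial_component (Q i))"

text \<open>
  \<open>D\<^bsub>\<alpha>\<sim>\<beta>\<^esub>\<close>; it is the null digraph if \<open>\<alpha> > \<beta>\<close>.
\<close>
definition component_range ::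
    "('a, 'b) pre_digraph \<Rightarrow> (nat \<Rightarrow> ('a, 'b) pre_digraph) \<Rightarrow> nat \<Rightarrow> nat \<Rightarrow> ('a, 'b) pre_digraph" where
  "component_range G Q \<alpha> \<beta> = G \<restriction> (\<Union>i\<in>{\<alpha>..\<beta>}. verts (Q i))"

definition imprimitivity_index :: "('a, 'b) pre_digraph \<Rightarrow> nat" where
  "imprimitivity_index H = Gcd {length p | p u. pre_digraph.awalk H u p u \<and> 0 < length p}"

text \<open>
  The successor of \<open>i\<close> in the cyclic order on \<open>{1..\<kappa>}\<close> is \<open>i mod \<kappa> + 1\<close>.
\<close>
definition sets_of_imprimitivity :: "('a, 'b) pre_digraph \<Rightarrow> (nat \<Rightarrow> 'a set) \<Rightarrow> bool" where
  "sets_of_imprimitivity H U \<longleftrightarrow>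
     (let \<kappa> = imprimitivity_index H in
       (\<forall>i\<in>{1..\<kappa>}. U i \<noteq> {}) \<and>
       disjoint_family_on U {1..\<kappa>} \<and>
       (\<Union>i\<in>{1..\<kappa>}. U i) = verts H \<and>
       (\<forall>e\<in>arcs H. \<exists>i\<in>{1..\<kappa>}. tail H e \<in> U i \<and> head H e \<in> U (i mod \<kappa> + 1)))"

definition partite_sets_of ::
    "nat \<Rightarrow> (nat \<Rightarrow> 'a set) \<Rightarrow> ('a, 'b) pre_digraph \<Rightarrow> 'a set set" where
  "partite_sets_of k V H = {verts H \<inter> V i | i. i \<in> {1..k} \<and> verts H \<inter> V i \<noteq> {}}"

definition partite_related :: "nat \<Rightarrow> (nat \<Rightarrow> 'a set) \<Rightarrow> 'a set \<Rightarrow> 'a set \<Rightarrow> bool" where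
  "partite_related k V X Y \<longleftrightarrow> (\<exists>i\<in>{1..k}. X \<subseteq> V i \<and> Y \<subseteq> V i)"

definition head_completing_index ::
    "nat \<Rightarrow> (nat \<Rightarrow> 'a set) \<Rightarrow> (nat \<Rightarrow> ('a, 'b) pre_digraph) \<Rightarrow> nat \<Rightarrow> nat" where
  "head_completing_index k V Q t =
     (let R = {r. 1 \<le> r \<and> r < t \<and>
                (\<exists>X\<in>partite_sets_of k V (Q r).
                   \<forall>Y\<in>partite_sets_of k V (Q t). \<not> partite_related k V X Y)}
      in if R = {} then 0 else Max R)"

definition blocks ::
    "(nat \<Rightarrow> ('a, 'b) pre_digraph) \<Rightarrow> (nat \<Rightarrow> 'a set) \<Rightarrow> nat \<Rightarrow> nat \<Rightarrow> 'a set \<Rightarrow> 'a set \<Rightarrow> nat \<Rightarrow> 'a set"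
  where
  "blocks Q U r t A1 A2 a =
     [\<Union>i\<in>{1..r}. verts (Q i), A1 - verts (Q t), A2 - verts (Q t), U 1, U 3, U 2, U 4] ! (a - 1)"

definition G4 ::
    "(nat \<Rightarrow> ('a, 'b) pre_digraph) \<Rightarrow> (nat \<Rightarrow> 'a set) \<Rightarrow> nat \<Rightarrow> nat \<Rightarrow> 'a set \<Rightarrow> 'a set \<Rightarrow> 'a sgraph"
  where
  "G4 Q U r t A1 A2 = clique_blowup 7 (blocks Q U r t A1 A2)
     {{1,2}, {1,3}, {1,4}, {1,5}, {1,6}, {1,7}, {2,4}, {2,5}, {3,6}, {3,7}, {4,5}}"

definition G5 ::
    "(nat \<Rightarrow> ('a, 'b) pre_digraph) \<Rightarrow> (nat \<Rightarrow> 'a set) \<Rightarrow> nat \<Rightarrow> nat \<Rightarrow> 'a set \<Rightarrow> 'a set \<Rightarrow> 'a sgraph"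
  where
  "G5 Q U r t A1 A2 = clique_blowup 7 (blocks Q U r t A1 A2)
     {{1,2}, {1,3}, {1,4}, {1,5}, {1,6}, {1,7}, {2,4}, {2,5}, {3,6}, {3,7}, {6,7}}"

end

theory Submission
  imports Defs
begin

text \<open>
  A strong component that is a bipartite tournament of index 4 is a blow-up of a directed
  4-cycle.  So a walk of length \<open>m \<ge> 1\<close> from \<open>U\<^sub>j\<close> that stays in \<open>Q\<^sub>t\<close> can end exactly in the vertices of
  \<open>U\<^sub>j\<^sub>+\<^sub>m\<close>.  A vertex up to the head completing index eventually reaches all of \<open>Q\<^sub>t\<close> in exactly
  \<open>m\<close> steps, since it reaches a vertex outside \<open>V\<^sub>1 \<union> V\<^sub>2\<close>, which dominates all of \<open>Q\<^sub>t\<close>; a vertex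
  between the head completing index and \<open>Q\<^sub>t\<close> dominates two opposite sets of imprimitivity, hence
  reaches a full partite set of \<open>Q\<^sub>t\<close>.  The trivial components after \<open>Q\<^sub>t\<close> carry no long walks, but
  each of their vertices is a common end point for every vertex of \<open>Q\<^sub>t\<close> outside its own partite
  set; when all of them lie in \<open>V\<^sub>1\<close> or \<open>V\<^sub>2\<close>, the parity of walk lengths decides who profits.
\<close>

section \<open>Competition graphs and powers of the arc relation\<close>

text \<open>Turns walks into relational powers. The condition \<open>u \<in> pverts D\<close>
  matters at \<open>m = 0\<close>, where the power is the identity on the whole type.\<close>

lemma awalk_length_iff_relpow:
  assumes "wf_digraph (with_proj D)"
  shows "(\<exists>p. pre_digraph.awalk (with_proj D) u p w \<and> length p = m) \<longleftrightarrow>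
    u \<in> pverts D \<and> (u, w) \<in> parcs D ^^ m"
proof (induction m arbitrary: u)
  case 0
  interpret wf_digraph "with_proj D" by (fact assms)
  show ?case by (auto simp: awalk_Nil_iff)
next
  case (Suc m)
  interpret wf_digraph "with_proj D" by (fact assms)
  have "(\<exists>p. awalk u p w \<and> length p = Suc m) \<longleftrightarrow>
      (\<exists>e q. awalk u (e # q) w \<and> length q = m)"
    unfolding length_Suc_conv by blast
  also have "\<dots> \<longleftrightarrow>
      (\<exists>v. (u, v) \<in> parcs D \<and> (\<exists>q. awalk v q w \<and> length q = m))"
    by (simp add: awalk_Cons_iff)
  also have "\<dots> \<longleftrightarrow> (\<exists>v. (u, v) \<in> parcs D \<and> v \<in> pverts D \<and> (v, w) \<in> parcs D ^^ m)"
    by (simp add: Suc.IH)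
  also have "\<dots> \<longleftrightarrow> u \<in> pverts D \<and> (u, w) \<in> parcs D ^^ Suc m"
  proof -
    have "v \<in> pverts D" "u \<in> pverts D" if "(u, v) \<in> parcs D" for u v
      using that tail_in_verts[of "(u, v)"] head_in_verts[of "(u, v)"] by auto
    moreover have "(u, w) \<in> parcs D ^^ Suc m \<longleftrightarrow> (\<exists>v. (u, v) \<in> parcs D \<and> (v, w) \<in> parcs D ^^ m)"
      by (meson relpow_Suc_D2 relpow_Suc_I2)
    ultimately show ?thesis by blast
  qed
  finally show ?case .
qed

lemma m_step_competition_graph_with_proj:
  assumes "wf_digraph (with_proj D)"
  shows "m_step_competition_graph m (with_proj D) = with_proj
     \<lparr> pverts = pverts D,
       parcs = {(u, v). u \<in> pverts D \<and> v \<in> pverts D \<and> u \<noteq> v \<and>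
         (parcs D ^^ m) `` {u} \<inter> (parcs D ^^ m) `` {v} \<noteq> {}} \<rparr>"
proof -
  have "(\<exists>w p q. pre_digraph.awalk (with_proj D) u p w \<and> length p = m \<and>
          pre_digraph.awalk (with_proj D) v q w \<and> length q = m) \<longleftrightarrow>
      u \<in> pverts D \<and> v \<in> pverts D \<and> (parcs D ^^ m) `` {u} \<inter> (parcs D ^^ m) `` {v} \<noteq> {}" for u v
    using awalk_length_iff_relpow[OF assms, of u _ m] awalk_length_iff_relpow[OF assms, of v _ m]
    by (auto simp: Image_iff set_eq_iff) metis
  then show ?thesis
    by (auto simp: m_step_competition_graph_def intro!: arg_cong[where f = with_proj])
qed

lemma digraph_iso_refl:
  assumes "wf_digraph G"
  shows "digraph_iso G G"
proof -
  interpret wf_digraph G by (fact assms)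
  let ?f = "\<lparr>iso_verts = id, iso_arcs = id, iso_head = head G, iso_tail = tail G\<rparr>"
  have "digraph_isomorphism ?f"
    by (auto simp: digraph_isomorphism_def assms)
  moreover have "G = app_iso ?f G"
    by (simp add: app_iso_def)
  ultimately show ?thesis
    unfolding digraph_iso_def by blast
qed

section \<open>Walks around a blow-up of a directed 4-cycle\<close>

text \<open>
  \<open>C 0, \<dots>, C 3\<close> are the sets of imprimitivity of the last nontrivial component and \<open>P 0, P 1\<close> the
  partite sets containing them, both indexed cyclically over all naturals, so that a step along
  an arc becomes a successor.  \<open>H\<close>, \<open>M\<close> and \<open>Z\<close> are the vertices of the components \<open>1, \<dots>, r\<close>, of
  the components strictly between \<open>r\<close> and \<open>t\<close>, and of those after \<open>t\<close>.
\<close>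
locale cyclic_core =
  fixes E :: "'a rel" and H M Z :: "'a set" and C P :: "nat \<Rightarrow> 'a set"
  assumes finite_H: "finite H"
    and C_add_4: "C (j + 4) = C j"
    and P_add_2: "P (j + 2) = P j"
    and P_disjoint: "P j \<inter> P (Suc j) = {}"
    and C_disjoint: "C j \<inter> C (j + 2) = {}"
    and C_nonempty: "C j \<noteq> {}"
    and C_subset_P: "C j \<subseteq> P j"
    and M_subset_P: "M \<subseteq> P 0 \<union> P 1"
    and Image_C: "u \<in> C j \<Longrightarrow> E `` {u} = C (Suc j) \<union> (Z - P j)"
    and C_subset_Image_M: "u \<in> M \<Longrightarrow> u \<in> P j \<Longrightarrow> C (Suc j) \<union> C (j + 3) \<subseteq> E `` {u}"
    and Image_M: "u \<in> M \<Longrightarrow> u \<in> P j \<Longrightarrow> E `` {u} \<subseteq> M \<union> (\<Union>i. C i) \<union> Z - P j"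
    and H_reaches_all: "u \<in> H \<Longrightarrow> \<exists>n x. (u, x) \<in> E ^^ n \<and> (\<Union>i. C i) \<subseteq> E `` {x}"
    and Image_Z: "E `` Z \<subseteq> Z" "u \<in> Z \<Longrightarrow> u \<in> P j \<Longrightarrow> E `` {u} \<inter> P j = {}"
    and Z_nilpotent: "\<exists>n. (E ^^ n) `` Z = {}"
begin

section \<open>Vertices reached in exactly \<open>m\<close> steps\<close>

definition "R m u = (E ^^ m) `` {u}"

lemma R_0: "R 0 u = {u}"
  by (simp add: R_def)

lemma R_Suc: "R (Suc m) u = E `` R m u"
  by (auto simp: R_def)

lemma R_add: "R (m + n) u = (\<Union>v\<in>R m u. R n v)"
  by (auto simp: R_def relpow_add)

lemma R_mono: "v \<in> R m u \<Longrightarrow> R n v \<subseteq> R (m + n) u"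
  by (auto simp: R_add)

lemma C_mod: "C (j mod 4) = C j"
proof -
  have "C (i + 4 * n) = C i" for i n
    by (induction n) (use C_add_4[of "i + 4 * n" for n] in \<open>auto simp: algebra_simps\<close>)
  from this[of "j mod 4" "j div 4"] show ?thesis by simp
qed

lemma P_mod: "P (j mod 2) = P j"
proof -
  have "P (i + 2 * n) = P i" for i n
    by (induction n) (use P_add_2[of "i + 2 * n" for n] in \<open>auto simp: algebra_simps\<close>)
  from this[of "j mod 2" "j div 2"] show ?thesis by simp
qed

lemma C_cong: "i mod 4 = j mod 4 \<Longrightarrow> C i = C j"
  by (metis C_mod)

lemma P_cong: "i mod 2 = j mod 2 \<Longrightarrow> P i = P j"
  by (metis P_mod)

lemma UN_C: "(\<Union>i. C i) = C j \<union> C (j + 1) \<union> C (j + 2) \<union> C (j + 3)"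
proof -
  have "C i \<subseteq> C j \<union> C (j + 1) \<union> C (j + 2) \<union> C (j + 3)" for i
  proof -
    \<comment> \<open>Modulo 4, \<open>3 * j\<close> stands for \<open>- j\<close>, so
      \<open>l\<close> is the offset from \<open>j\<close> to \<open>i\<close> without truncated
      subtraction.\<close>
    define l where "l = (i + 3 * j) mod 4"
    have "(j + l) mod 4 = (i + j * 4) mod 4"
      unfolding l_def mod_add_right_eq by (simp add: algebra_simps)
    then have "C i = C (j + l)"
      by (intro C_cong) simp
    moreover have "l \<in> {0, 1, 2, 3}"
      unfolding l_def by auto
    ultimately show ?thesis by auto
  qed
  then show ?thesis by blast
qed

lemma UN_P: "(\<Union>i. P i) = P 0 \<union> P 1"
proof -
  have "P i \<subseteq> P 0 \<union> P 1" for i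
    using P_mod[of i] by (cases "even i") (auto simp: odd_iff_mod_2_eq_one)
  then show ?thesis by blast
qed

text \<open>Every arc leaves its partite set, and when \<open>Z\<close> avoids the other partite
  sets only two are available beyond \<open>H\<close>; the arc must enter the second one.\<close>

lemma Image_subset_P_Suc:
  assumes "u \<in> M \<union> (\<Union>i. C i) \<union> Z" "Z \<subseteq> P 0 \<union> P 1" "u \<in> P j"
  shows "E `` {u} \<subseteq> (M \<union> (\<Union>i. C i) \<union> Z) \<inter> P (Suc j)"
proof -
  have all: "M \<union> (\<Union>i. C i) \<union> Z \<subseteq> P j \<union> P (Suc j)"
  proof -
    have "P 0 \<union> P 1 \<subseteq> P j \<union> P (Suc j)"
      using P_mod[of j] P_mod[of "Suc j"] by (cases "even j") (auto simp: odd_iff_mod_2_eq_one mod_Suc)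
    then show ?thesis
      using UN_P C_subset_P M_subset_P assms(2) by blast
  qed
  have "E `` {u} \<subseteq> M \<union> (\<Union>i. C i) \<union> Z - P j"
  proof -
    consider "u \<in> M" | i where "u \<in> C i" | "u \<in> Z" using assms(1) by blast
    then show ?thesis
    proof cases
      case 1 then show ?thesis using Image_M assms(3) by blast
    next
      case (2 i)
      \<comment> \<open>Indices of different parity would put \<open>u\<close> into two disjoint
        partite sets.\<close>
      have "P i = P j"
      proof (cases "even (i + j)")
        case True
        then show ?thesis by (intro P_cong) presburger
      next
        case False
        then have "P (Suc i) = P j" by (intro P_cong) presburger
        then show ?thesis using P_disjoint[of i] C_subset_P[of i] 2 assms(3) by blast
      qed
      then show ?thesis using Image_C[OF 2] C_subset_P[of "Suc i"] P_disjoint[of i] by blast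
    next
      case 3 then show ?thesis using Image_Z assms(3) by blast
    qed
  qed
  then show ?thesis using all by blast
qed

text \<open>Walks alternate between the two partite sets. This is where the parity of
  \<open>m\<close> enters the result.\<close>

lemma R_subset_P:
  assumes "u \<in> (M \<union> (\<Union>i. C i) \<union> Z) \<inter> P j" "Z \<subseteq> P 0 \<union> P 1"
  shows "R m u \<subseteq> (M \<union> (\<Union>i. C i) \<union> Z) \<inter> P (j + m)"
proof (induction m)
  case 0 then show ?case using assms by (simp add: R_0)
next
  case (Suc m)
  have "E `` {v} \<subseteq> (M \<union> (\<Union>i. C i) \<union> Z) \<inter> P (j + Suc m)" if "v \<in> R m u" for v
    using Image_subset_P_Suc[OF _ assms(2), of v "j + m"] Suc that unfolding add_Suc_right by blast
  then show ?case
    unfolding R_Suc by blast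
qed

text \<open>A walk from the core advances by one set per step until it leaves for \<open>Z\<close>,
  from which it cannot return.\<close>

lemma R_C_subset:
  assumes "u \<in> C j"
  shows "R m u \<subseteq> C (j + m) \<union> Z"
proof (induction m)
  case 0 then show ?case using assms by (simp add: R_0)
next
  case (Suc m)
  have "E `` {v} \<subseteq> C (j + Suc m) \<union> Z" if "v \<in> R m u" for v
    using Image_C[of v "j + m"] Image_Z(1) Suc that by auto
  then show ?case
    unfolding R_Suc by blast
qed

text \<open>One reached vertex of a set is enough to reach the whole next set, since consecutive
  sets are completely joined.\<close>

lemma C_subset_R:
  assumes "u \<in> C j"
  shows "m > 0 \<Longrightarrow> C (j + m) \<subseteq> R m u"
proof (induction m)
  case 0 then show ?case by simp
next
  case (Suc m)
  show ?case
  proof (cases "m = 0")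
    case True
    then show ?thesis using Image_C[OF assms] by (simp add: R_Suc R_0)
  next
    case False
    then obtain w where "w \<in> C (j + m)" "w \<in> R m u" using Suc C_nonempty[of "j + m"] by blast
    then show ?thesis using Image_C[of w "j + m"] unfolding R_Suc by auto
  qed
qed

text \<open>The first step can enter either of two opposite sets; the remaining
  \<open>m - 1 > 0\<close> steps rotate both.\<close>

lemma C_subset_R_M:
  assumes "u \<in> M" "u \<in> P j" "m > 1"
  shows "C (j + m) \<union> C (j + m + 2) \<subseteq> R m u"
proof -
  obtain n where n: "m = Suc n" "n > 0" using assms(3) by (cases m) auto
  obtain a b where ab: "a \<in> C (Suc j)" "b \<in> C (j + 3)" "a \<in> R 1 u" "b \<in> R 1 u"
    using C_subset_Image_M[OF assms(1,2)] C_nonempty[of "Suc j"] C_nonempty[of "j + 3"]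
    by (simp add: R_Suc R_0) blast
  have "C (Suc j + n) \<subseteq> R (1 + n) u" "C (j + 3 + n) \<subseteq> R (1 + n) u"
    using R_mono[OF ab(3), of n] R_mono[OF ab(4), of n] C_subset_R[OF ab(1) n(2)] C_subset_R[OF ab(2) n(2)]
    by blast+
  then show ?thesis using n by (simp add: eval_nat_numeral)
qed

text \<open>A walk first goes to a vertex dominating the core, then enters the core at a set of free
  choice and rotates. The bound depends on \<open>u\<close>; finiteness of \<open>H\<close> makes it
  uniform.\<close>

lemma eventually_C_subset_R_H:
  "eventually (\<lambda>m. \<forall>u\<in>H. (\<Union>i. C i) \<subseteq> R m u) sequentially"
proof (rule eventually_ball_finite[OF finite_H], rule)
  fix u assume "u \<in> H"
  then obtain n x where x: "(u, x) \<in> E ^^ n" "(\<Union>i. C i) \<subseteq> E `` {x}" using H_reaches_all by blast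
  have "C i \<subseteq> R m u" if m: "m \<ge> n + 2" for m i
  proof -
    define l where "l = m - n - 1"
    then have l: "m = n + (1 + l)" "l > 0" using m by auto
    \<comment> \<open>Modulo 4, \<open>3 * l\<close> stands for \<open>- l\<close>: rotating
      \<open>l\<close> steps from this set ends in \<open>C i\<close>.\<close>
    obtain w where w: "w \<in> C (i + 3 * l)" using C_nonempty by blast
    have "w \<in> R (n + 1) u" using x w by (auto simp: R_Suc R_def)
    then have "R l w \<subseteq> R m u" using R_mono l by (metis add.assoc)
    moreover have "C (i + 3 * l + l) \<subseteq> R l w" using C_subset_R[OF w l(2)] .
    moreover have "C (i + 3 * l + l) = C i" by (rule C_cong) presburger
    ultimately show ?thesis by simp
  qed
  then show "eventually (\<lambda>m. (\<Union>i. C i) \<subseteq> R m u) sequentially"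
    by (auto intro: eventually_sequentiallyI)
qed

lemma eventually_R_Z: "eventually (\<lambda>m. \<forall>u\<in>Z. R m u = {}) sequentially"
proof -
  obtain n where n: "(E ^^ n) `` Z = {}" using Z_nilpotent by blast
  have "R m u = {}" if "m \<ge> n" "u \<in> Z" for m u
  proof -
    have "R n u = {}" using n that by (auto simp: R_def)
    then show ?thesis using R_add[of n "m - n" u] that by simp
  qed
  then show ?thesis by (auto intro: eventually_sequentiallyI)
qed

text \<open>Long walks cannot stay in \<open>Z\<close>, but they can enter it with their last arc.
  This is how \<open>Z\<close> supplies common end points.\<close>

lemma in_R_Z:
  assumes "v \<in> C i" "v \<in> R m u" "z \<in> Z" "z \<notin> P i"
  shows "z \<in> R (Suc m) u"
  using assms Image_C unfolding R_Suc by blast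

lemma C_meets_R:
  assumes "u \<in> M \<union> (\<Union>i. C i)" "m > 1"
  shows "\<exists>i v. v \<in> C i \<and> v \<in> R m u"
proof -
  consider j where "u \<in> M" "u \<in> P j" | j where "u \<in> C j" using assms M_subset_P by blast
  then show ?thesis
  proof cases
    case (1 j) then show ?thesis using C_subset_R_M[of u j m] C_nonempty assms by blast
  next
    case (2 j) then show ?thesis using C_subset_R[of u j m] C_nonempty assms by (metis equals0I gr_zeroI not_one_less_zero subsetD)
  qed
qed

section \<open>Common end points of walks of length \<open>m\<close>\<close>

definition "adj m u v \<longleftrightarrow> R m u \<inter> R m v \<noteq> {}"

lemma adj_commute: "adj m u v \<longleftrightarrow> adj m v u"
  by (auto simp: adj_def)

text \<open>Membership in \<open>P j\<close> fixes the parity of \<open>i\<close>, which leaves two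
  residues modulo 4.\<close>

lemma C_parity:
  assumes "u \<in> C i" "u \<in> P j"
  shows "C i = C j \<or> C i = C (j + 2)"
proof -
  have "even (i + j)"
  proof (rule ccontr)
    assume "odd (i + j)"
    then have "P (Suc i) = P j" by (intro P_cong) presburger
    then show False using assms C_subset_P[of i] P_disjoint[of i] by blast
  qed
  define l where "l = (i + 3 * j) mod 4"
  have "even l"
    using \<open>even (i + j)\<close> by (simp add: l_def dvd_mod_iff)
  moreover have "l < 4"
    by (simp add: l_def)
  ultimately have l: "l = 0 \<or> l = 2"
    by presburger
  have "(j + l) mod 4 = (i + j * 4) mod 4"
    unfolding l_def mod_add_right_eq by (simp add: algebra_simps)
  then have "C i = C (j + l)"
    by (intro C_cong) simp
  with l show ?thesis by (metis add_0_right)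
qed

text \<open>After \<open>m - 1\<close> steps both vertices can be at core vertices in the partite
  set opposite to that of \<open>z\<close>, and these dominate \<open>z\<close>.\<close>

lemma adj_same_part_tail:
  assumes "u \<in> (M \<union> (\<Union>i. C i)) \<inter> P j" "v \<in> (M \<union> (\<Union>i. C i)) \<inter> P j"
    and "m > 2" "Z \<inter> P (j + m) \<noteq> {}"
  shows "adj m u v"
proof -
  obtain n where n: "m = Suc n" "n > 1" using assms(3) by (cases m) auto
  obtain z where z: "z \<in> Z" "z \<in> P (j + m)" using assms(4) by blast
  have "z \<in> R m x" if x: "x \<in> (M \<union> (\<Union>i. C i)) \<inter> P j" for x
  proof -
    have "\<exists>i. C i \<subseteq> R n x \<and> P i = P (j + n)"
    proof -
      consider "x \<in> M" | "x \<in> C j" | "x \<in> C (j + 2)" using x C_parity by blast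
      then show ?thesis
      proof cases
        case 1
        then show ?thesis using C_subset_R_M[of x j n] x n by blast
      next
        case 2
        then show ?thesis using C_subset_R[of x j n] n by auto
      next
        case 3
        have "P (j + 2 + n) = P (j + n)" by (rule P_cong) presburger
        then show ?thesis using C_subset_R[OF 3, of n] n by auto
      qed
    qed
    then obtain w i where w: "w \<in> R n x" "w \<in> C i" "P i = P (j + n)"
      using C_nonempty by (metis all_not_in_conv subsetD)
    have "z \<notin> P i" using w z n P_disjoint[of "j + n"] by auto
    then show ?thesis using in_R_Z[OF w(2,1) z(1)] n by simp
  qed
  then show ?thesis using assms(1,2) unfolding adj_def by blast
qed

text \<open>Walks from \<open>u\<close> fill both core sets of \<open>P (j + m)\<close>, while those
  from \<open>v\<close> fill at least one of them.\<close>

lemma adj_M: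
  assumes "u \<in> M \<inter> P j" "v \<in> (M \<union> (\<Union>i. C i)) \<inter> P j" "m > 1"
  shows "adj m u v"
proof -
  consider "v \<in> M" | "v \<in> C j" | "v \<in> C (j + 2)" using assms(2) C_parity by blast
  then have "C (j + m) \<subseteq> R m v \<or> C (j + m + 2) \<subseteq> R m v"
  proof cases
    case 1 then show ?thesis using C_subset_R_M[of v j m] assms by blast
  next
    case 2 then show ?thesis using C_subset_R[of v j m] assms by auto
  next
    case 3 then show ?thesis using C_subset_R[of v "j + 2" m] assms by (auto simp: ac_simps)
  qed
  then show ?thesis
    using C_subset_R_M[of u j m] assms C_nonempty[of "j + m"] C_nonempty[of "j + m + 2"]
    unfolding adj_def by blast
qed

lemma adj_C:
  assumes "u \<in> C j" "v \<in> C j" "m > 0"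
  shows "adj m u v"
  using C_subset_R[of u j m] C_subset_R[of v j m] assms C_nonempty[of "j + m"] unfolding adj_def by blast

text \<open>Opposite sets stay opposite under rotation. End points in \<open>Z\<close> are excluded,
  because all end points lie in \<open>P (j + m)\<close>, which misses \<open>Z\<close>.\<close>

lemma not_adj_C:
  assumes "u \<in> C j" "v \<in> C (j + 2)" "Z \<subseteq> P 0 \<union> P 1" "Z \<inter> P (j + m) = {}"
  shows "\<not> adj m u v"
proof -
  have "R m u \<subseteq> C (j + m)"
    using R_C_subset[OF assms(1), of m] R_subset_P[of u j m] assms C_subset_P[of j] by blast
  moreover have "R m v \<subseteq> C (j + m + 2)"
  proof -
    have "P (j + 2 + m) = P (j + m)" by (rule P_cong) presburger
    then show ?thesis
      using R_C_subset[OF assms(2), of m] R_subset_P[of v "j + 2" m] assms C_subset_P[of "j + 2"]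
      unfolding add.assoc add.commute[of m 2] by blast
  qed
  ultimately show ?thesis using C_disjoint[of "j + m"] unfolding adj_def by blast
qed

text \<open>Walks of equal length alternate in step, so starting in different partite sets they end
  in different ones.\<close>

lemma not_adj_P:
  assumes "u \<in> (M \<union> (\<Union>i. C i)) \<inter> P 0" "v \<in> (M \<union> (\<Union>i. C i)) \<inter> P 1" "Z \<subseteq> P 0 \<union> P 1"
  shows "\<not> adj m u v"
proof -
  have "R m u \<subseteq> P m" "R m v \<subseteq> P (Suc m)"
    using R_subset_P[of u 0 m] R_subset_P[of v 1 m] assms by auto
  then show ?thesis using P_disjoint[of m] unfolding adj_def by blast
qed

lemma adj_H:
  assumes "(\<Union>i. C i) \<subseteq> R m u" "(\<Union>i. C i) \<subseteq> R m v \<or> v \<in> M \<union> (\<Union>i. C i)" "m > 1"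
  shows "adj m u v"
  using C_meets_R[of v m] C_nonempty[of 0] assms unfolding adj_def by blast

lemma adj_iff_same_part:
  assumes "u \<in> M \<union> (\<Union>i. C i)" "v \<in> M \<union> (\<Union>i. C i)" "Z \<subseteq> P 0 \<union> P 1" "m > 2"
  shows "adj m u v \<longleftrightarrow> (\<exists>j\<in>{0, 1}. u \<in> P j \<and> v \<in> P j \<and>
    (Z \<inter> P (j + m) \<noteq> {} \<or> u \<in> M \<or> v \<in> M \<or> (\<exists>i. u \<in> C i \<and> v \<in> C i)))"
    (is "_ \<longleftrightarrow> ?R")
proof
  assume ?R
  then obtain j where j: "u \<in> P j" "v \<in> P j"
    "Z \<inter> P (j + m) \<noteq> {} \<or> u \<in> M \<or> v \<in> M \<or> (\<exists>i. u \<in> C i \<and> v \<in> C i)" by blast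
  then show "adj m u v"
    using adj_same_part_tail[of u j v m] adj_M[of u j v m] adj_M[of v j u m] adj_commute[of m u v]
      adj_C[of u _ v m] assms by auto
next
  assume adj: "adj m u v"
  have uv: "u \<in> P 0 \<union> P 1" "v \<in> P 0 \<union> P 1"
    using assms(1,2) M_subset_P C_subset_P UN_P by blast+
  have "\<not> (u \<in> P 0 \<and> v \<in> P 1)" "\<not> (v \<in> P 0 \<and> u \<in> P 1)"
    using adj not_adj_P[of u v m] not_adj_P[of v u m] adj_commute[of m u v] assms by blast+
  then obtain j where j: "j \<in> {0, 1}" "u \<in> P j" "v \<in> P j"
    using uv by blast
  \<comment> \<open>Two core vertices in one partite set but in no common set of imprimitivity lie
    in opposite sets, where only \<open>Z\<close> can provide a common end point.\<close>
  moreover have "Z \<inter> P (j + m) \<noteq> {}"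
    if uv: "u \<notin> M" "v \<notin> M" "\<nexists>i. u \<in> C i \<and> v \<in> C i"
  proof -
    have "u \<in> C j \<or> u \<in> C (j + 2)" "v \<in> C j \<or> v \<in> C (j + 2)"
      using uv assms C_parity j by blast+
    then have "u \<in> C j \<and> v \<in> C (j + 2) \<or> v \<in> C j \<and> u \<in> C (j + 2)"
      using uv by blast
    then show ?thesis
      using not_adj_C[of u j v m] not_adj_C[of v j u m] adj adj_commute[of m u v] assms(3) by blast
  qed
  ultimately show ?R by blast
qed

text \<open>A vertex of \<open>Z\<close> outside both partite sets is dominated by the whole core,
  so it is one common end point for all vertices concerned.\<close>

lemma eventually_adj_complete:
  assumes "\<not> Z \<subseteq> P 0 \<union> P 1"
  shows "eventually (\<lambda>m. \<forall>u\<in>H \<union> M \<union> (\<Union>i. C i). \<forall>v\<in>H \<union> M \<union> (\<Union>i. C i). adj m u v) sequentially"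
proof -
  obtain z where z: "z \<in> Z" "\<And>i. z \<notin> P i" using assms UN_P by blast
  have "eventually (\<lambda>m. \<forall>u\<in>H \<union> M \<union> (\<Union>i. C i). z \<in> R (Suc m) u) sequentially"
    using eventually_C_subset_R_H eventually_gt_at_top[of 1]
  proof eventually_elim
    case (elim m)
    show ?case
    proof
      fix u assume u: "u \<in> H \<union> M \<union> (\<Union>i. C i)"
      have "\<exists>i v. v \<in> C i \<and> v \<in> R m u"
      proof (cases "u \<in> H")
        case True
        then have "C 0 \<subseteq> R m u" using elim(1) by blast
        then show ?thesis using C_nonempty[of 0] by blast
      next
        case False
        then show ?thesis using u C_meets_R[of u m] elim(2) by simp
      qed
      then show "z \<in> R (Suc m) u" using in_R_Z z by blast
    qed
  qed
  then have "eventually (\<lambda>m. \<forall>u\<in>H \<union> M \<union> (\<Union>i. C i). z \<in> R m u) sequentially"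
    by (subst (asm) eventually_sequentially_Suc)
  then show ?thesis by eventually_elim (auto simp: adj_def)
qed

text \<open>For large \<open>m\<close> a vertex of \<open>H\<close> reaches the whole core and so
  meets the walks of every vertex not in \<open>Z\<close>; pairs outside \<open>H\<close> are
  settled by \<open>adj_iff_same_part\<close>.\<close>

lemma eventually_adj_iff:
  assumes "Z \<subseteq> P 0 \<union> P 1"
  shows "eventually (\<lambda>m. \<forall>u v. u \<in> H \<union> M \<union> (\<Union>i. C i) \<longrightarrow> v \<in> H \<union> M \<union> (\<Union>i. C i) \<longrightarrow>
    (adj m u v \<longleftrightarrow> u \<in> H \<or> v \<in> H \<or> (\<exists>j\<in>{0, 1}. u \<in> P j \<and> v \<in> P j \<and>
      (Z \<inter> P (j + m) \<noteq> {} \<or> u \<in> M \<or> v \<in> M \<or> (\<exists>i. u \<in> C i \<and> v \<in> C i))))) sequentially"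
  using eventually_C_subset_R_H eventually_gt_at_top[of 2]
proof eventually_elim
  case (elim m)
  have "adj m u v" if "u \<in> H" "v \<in> H \<union> M \<union> (\<Union>i. C i)" for u v
    using adj_H[of m u v] elim that by auto
  note adj_HX = this
  have "adj m u v \<longleftrightarrow> u \<in> H \<or> v \<in> H \<or> (\<exists>j\<in>{0, 1}. u \<in> P j \<and> v \<in> P j \<and>
      (Z \<inter> P (j + m) \<noteq> {} \<or> u \<in> M \<or> v \<in> M \<or> (\<exists>i. u \<in> C i \<and> v \<in> C i)))"
    if "u \<in> H \<union> M \<union> (\<Union>i. C i)" "v \<in> H \<union> M \<union> (\<Union>i. C i)" for u v
  proof (cases "u \<in> H \<or> v \<in> H")
    case True
    then show ?thesis using adj_HX[of u v] adj_HX[of v u] that adj_commute[of m u v] by auto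
  next
    case False
    then show ?thesis using adj_iff_same_part[OF _ _ assms elim(2), of u v] that by simp
  qed
  then show ?case by simp
qed

lemma eventually_not_adj_Z:
  "eventually (\<lambda>m. \<forall>u v. u \<in> Z \<or> v \<in> Z \<longrightarrow> \<not> adj m u v) sequentially"
  using eventually_R_Z by eventually_elim (auto simp: adj_def)

section \<open>The seven blocks and their adjacencies\<close>

lemma C_subset_P_0_1: "C 0 \<subseteq> P 0" "C 1 \<subseteq> P 1" "C 2 \<subseteq> P 0" "C 3 \<subseteq> P 1"
proof -
  have "P 2 = P 0" "P 3 = P 1" by (rule P_cong; simp)+
  then show "C 0 \<subseteq> P 0" "C 1 \<subseteq> P 1" "C 2 \<subseteq> P 0" "C 3 \<subseteq> P 1"
    using C_subset_P by metis+
qed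

lemma UN_C_0: "(\<Union>i. C i) = C 0 \<union> C 1 \<union> C 2 \<union> C 3"
  using UN_C[of 0] unfolding add_0 .

lemma M_Un_UN_C: "M \<union> (\<Union>i. C i) = M \<inter> P 0 \<union> M \<inter> P 1 \<union> C 0 \<union> C 1 \<union> C 2 \<union> C 3"
  unfolding UN_C_0 using M_subset_P by blast

text \<open>The order is that of \<open>blocks\<close>, which groups the sets of imprimitivity by
  partite set; hence \<open>C 2\<close> comes before \<open>C 1\<close>.\<close>

definition "block a = [H, M \<inter> P 0, M \<inter> P 1, C 0, C 2, C 1, C 3] ! (a - 1)"

lemma block_simps:
  "block 1 = H" "block (Suc 0) = H" "block 2 = M \<inter> P 0" "block 3 = M \<inter> P 1" "block 4 = C 0" "block 5 = C 2"
  "block 6 = C 1" "block 7 = C 3"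
  by (simp_all add: block_def)

lemma atLeastAtMost_1_7: "{1..7::nat} = {1, 2, 3, 4, 5, 6, 7}"
  by auto

lemma UN_block: "(\<Union>a\<in>{1..7}. block a) = H \<union> M \<union> (\<Union>i. C i)"
  unfolding atLeastAtMost_1_7 Un_assoc[of H] M_Un_UN_C
  by (simp add: block_simps del: One_nat_def) blast

abbreviation "G4_pairs \<equiv> {{1,2}, {1,3}, {1,4}, {1,5}, {1,6}, {1,7}, {2,4}, {2,5}, {3,6}, {3,7}, {4,5::nat}}"
abbreviation "G5_pairs \<equiv> {{1,2}, {1,3}, {1,4}, {1,5}, {1,6}, {1,7}, {2,4}, {2,5}, {3,6}, {3,7}, {6,7::nat}}"

text \<open>\<open>e\<close> names the partite set whose two opposite core sets are joined: the pair
  \<open>{4, 5}\<close> for \<open>e = 0\<close>, the pair \<open>{6, 7}\<close> for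
  \<open>e = 1\<close>. The right side has the shape of \<open>eventually_adj_iff\<close>, with
  \<open>j = e\<close> for the condition on \<open>Z\<close>.\<close>

lemma block_pairs:
  assumes "e \<in> {0, 1}"
  shows "(\<exists>a\<in>{1..7}. \<exists>b\<in>{1..7}. u \<in> block a \<and> v \<in> block b \<and>
      (a = b \<or> {a, b} \<in> (if e = 0 then G4_pairs else G5_pairs))) \<longleftrightarrow>
    u \<in> H \<union> M \<union> (\<Union>i. C i) \<and> v \<in> H \<union> M \<union> (\<Union>i. C i) \<and>
      (u \<in> H \<or> v \<in> H \<or> (\<exists>j\<in>{0, 1}. u \<in> P j \<and> v \<in> P j \<and>
        (j = e \<or> u \<in> M \<or> v \<in> M \<or> (\<exists>i. u \<in> C i \<and> v \<in> C i))))" (is "?L \<longleftrightarrow> ?R")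
proof -
  have same: "(\<exists>i. u \<in> C i \<and> v \<in> C i) \<longleftrightarrow>
      (u \<in> C 0 \<and> v \<in> C 0) \<or> (u \<in> C 1 \<and> v \<in> C 1) \<or> (u \<in> C 2 \<and> v \<in> C 2) \<or> (u \<in> C 3 \<and> v \<in> C 3)" (is "?A \<longleftrightarrow> ?B")
  proof
    assume ?A
    then obtain i where "u \<in> C (i mod 4)" "v \<in> C (i mod 4)" using C_mod by blast
    moreover have "i mod 4 \<in> {0, 1, 2, 3}" by auto
    ultimately show ?B by auto
  qed blast
  have L: "?L \<longleftrightarrow>
      u \<in> H \<and> (v \<in> H \<or> v \<in> M \<inter> P 0 \<or> v \<in> M \<inter> P 1 \<or> v \<in> C 0 \<or> v \<in> C 1 \<or> v \<in> C 2 \<or> v \<in> C 3) \<or>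
      v \<in> H \<and> (u \<in> H \<or> u \<in> M \<inter> P 0 \<or> u \<in> M \<inter> P 1 \<or> u \<in> C 0 \<or> u \<in> C 1 \<or> u \<in> C 2 \<or> u \<in> C 3) \<or>
      (\<exists>j\<in>{0, 1}. u \<in> M \<inter> P j \<and> (v \<in> M \<inter> P j \<or> v \<in> C j \<or> v \<in> C (j + 2)) \<or>
        v \<in> M \<inter> P j \<and> (u \<in> M \<inter> P j \<or> u \<in> C j \<or> u \<in> C (j + 2)) \<or>
        u \<in> C j \<and> v \<in> C j \<or> u \<in> C (j + 2) \<and> v \<in> C (j + 2) \<or>
        j = e \<and> (u \<in> C j \<and> v \<in> C (j + 2) \<or> u \<in> C (j + 2) \<and> v \<in> C j))" (is "_ \<longleftrightarrow> ?L'")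
  proof (cases "e = 0")
    case True
    then show ?thesis
      unfolding atLeastAtMost_1_7 bex_simps
      by (simp add: block_simps doubleton_eq_iff numeral_2_eq_2[symmetric] numeral_3_eq_3[symmetric] del: One_nat_def)
        argo
  next
    case False
    then have "e = 1" using assms by blast
    then show ?thesis
      unfolding atLeastAtMost_1_7 bex_simps
      by (simp add: block_simps doubleton_eq_iff numeral_2_eq_2[symmetric] numeral_3_eq_3[symmetric] del: One_nat_def)
        argo
  qed
  have Y: "x \<in> M \<union> (\<Union>i. C i) \<longleftrightarrow> x \<in> M \<inter> P 0 \<or> x \<in> M \<inter> P 1 \<or> x \<in> C 0 \<or> x \<in> C 1 \<or> x \<in> C 2 \<or> x \<in> C 3" for x
    unfolding M_Un_UN_C by blast
  have PP: "P 0 \<inter> P 1 = {}" using P_disjoint[of 0] by simp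
  show ?thesis
  proof (cases "u \<in> H \<or> v \<in> H")
    case True
    then show ?thesis unfolding L Un_assoc using Y[of u] Y[of v] by blast
  next
    case False
    have "?L' \<longleftrightarrow> ?R" if "u \<in> M \<union> (\<Union>i. C i)" "v \<in> M \<union> (\<Union>i. C i)"
    proof -
      \<comment> \<open>The partite set of a vertex decides its membership in all sets of the other
        parity. After this split the equivalence is propositional.\<close>
      have split: "x \<in> P 0 \<and> x \<notin> P 1 \<and> x \<notin> C 1 \<and> x \<notin> C 3 \<and> (x \<in> M \<or> x \<in> C 0 \<or> x \<in> C 2) \<or>
          x \<notin> P 0 \<and> x \<in> P 1 \<and> x \<notin> C 0 \<and> x \<notin> C 2 \<and> (x \<in> M \<or> x \<in> C 1 \<or> x \<in> C 3)"
        if "x \<in> M \<union> (\<Union>i. C i)" for x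
        using that PP C_subset_P_0_1 unfolding M_Un_UN_C by blast
      have sums: "0 + 2 = (2::nat)" "1 + 2 = (3::nat)" by simp_all
      have YH: "u \<in> H \<union> M \<union> (\<Union>i. C i) \<and> v \<in> H \<union> M \<union> (\<Union>i. C i)" using that by simp
      show ?thesis
        using split[OF that(1)] split[OF that(2)] False YH assms
        unfolding same bex_simps sums Int_iff insert_iff empty_iff
        by (elim disjE conjE; simp del: One_nat_def; blast?)
    qed
    moreover have "u \<in> M \<union> (\<Union>i. C i)" "v \<in> M \<union> (\<Union>i. C i)" if "?L'"
      using that False C_subset_P_0_1 unfolding Y
      by (auto simp: numeral_2_eq_2[symmetric] numeral_3_eq_3[symmetric] simp del: One_nat_def)
    moreover have "u \<in> M \<union> (\<Union>i. C i)" "v \<in> M \<union> (\<Union>i. C i)" if "?R"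
      using that False by simp_all
    ultimately show ?thesis unfolding L by argo
  qed
qed

end

section \<open>Strong components of partite tournaments\<close>

locale ordered_partite_tournament =
  fixes D :: "'a pair_pre_digraph" and k :: nat and V :: "nat \<Rightarrow> 'a set"
    and s :: nat and Q :: "nat \<Rightarrow> ('a, 'a \<times> 'a) pre_digraph"
  assumes partite: "partite_tournament D k V"
    and ordered: "ordered_strong_components (with_proj D) s Q"
begin

lemma pair_digraph: "pair_digraph D"
  using partite by (simp add: partite_tournament_def)

sublocale pair_digraph D
  by (fact pair_digraph)

lemma Q_in_sccs: "i \<in> {1..s} \<Longrightarrow> Q i \<in> sccs"
  using ordered unfolding ordered_strong_components_def bij_betw_def by blast

lemma verts_Q_in_sccs_verts: "i \<in> {1..s} \<Longrightarrow> verts (Q i) \<in> sccs_verts"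
  using Q_in_sccs in_sccs_vertsI_sccs by blast

lemma UN_verts_Q: "(\<Union>i\<in>{1..s}. verts (Q i)) = pverts D"
proof -
  have "Q ` {1..s} = sccs"
    using ordered unfolding ordered_strong_components_def bij_betw_def by (elim conjE)
  then have "(\<Union>i\<in>{1..s}. verts (Q i)) = \<Union> (verts ` sccs)"
    by (simp add: image_image flip: \<open>Q ` {1..s} = sccs\<close>)
  also have "\<dots> = \<Union> (scc_of ` pverts D)"
    using sccs_verts_conv sccs_verts_conv_scc_of by simp
  also have "\<dots> = pverts D"
  proof
    show "\<Union> (scc_of ` pverts D) \<subseteq> pverts D"
      using sccs_verts_subsets sccs_verts_conv_scc_of by blast
    show "pverts D \<subseteq> \<Union> (scc_of ` pverts D)"
      using in_scc_of_self by blast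
  qed
  finally show ?thesis .
qed

lemma verts_Q_subset: "i \<in> {1..s} \<Longrightarrow> verts (Q i) \<subseteq> pverts D"
  using UN_verts_Q by blast

lemma verts_Q_disjoint:
  assumes "u \<in> verts (Q i)" "u \<in> verts (Q j)" "i \<in> {1..s}" "j \<in> {1..s}"
  shows "i = j"
proof -
  have "verts (Q i) = verts (Q j)"
    using sccs_verts_disjoint[OF verts_Q_in_sccs_verts verts_Q_in_sccs_verts, of i j] assms by blast
  then have "Q i = Q j"
    using inj_on_verts_sccs Q_in_sccs assms(3,4) by (meson inj_onD)
  then show ?thesis
    using ordered assms(3,4) unfolding ordered_strong_components_def bij_betw_def inj_on_def by blast
qed

text \<open>Components are induced subgraphs. This lets the imprimitivity condition, stated for arcs
  of \<open>Q i\<close>, be applied to arcs of \<open>D\<close>.\<close>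

lemma arc_in_Q:
  assumes "(u, v) \<in> parcs D" "u \<in> verts (Q i)" "v \<in> verts (Q i)" "i \<in> {1..s}"
  shows "(u, v) \<in> arcs (Q i)" "tail (Q i) (u, v) = u" "head (Q i) (u, v) = v"
proof -
  have "induced_subgraph (Q i) (with_proj D)"
    using Q_in_sccs[OF assms(4)] by (rule in_sccs_imp_induced)
  then show "(u, v) \<in> arcs (Q i)" "tail (Q i) (u, v) = u" "head (Q i) (u, v) = v"
    using assms unfolding induced_subgraph_def subgraph_def compatible_def by auto
qed

lemma arc_le:
  assumes "(u, v) \<in> parcs D" "u \<in> verts (Q i)" "i \<in> {1..s}"
  obtains j where "v \<in> verts (Q j)" "i \<le> j" "j \<in> {1..s}"
proof -
  obtain j where j: "v \<in> verts (Q j)" "j \<in> {1..s}"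
    using in_arcsD2[OF assms(1)] unfolding UN_verts_Q[symmetric] by blast
  moreover have "i \<le> j"
  proof (rule ccontr)
    assume "\<not> i \<le> j"
    then have "\<not> u \<rightarrow>\<^bsub>with_proj D\<^esub> v"
      using ordered assms(2,3) j unfolding ordered_strong_components_def by (metis not_le)
    then show False using assms(1) by simp
  qed
  ultimately show ?thesis using that by blast
qed

lemma part_ex: "u \<in> pverts D \<Longrightarrow> \<exists>a\<in>{1..k}. u \<in> V a"
  using partite unfolding partite_tournament_def by blast

lemma part_unique: "\<lbrakk>u \<in> V a; u \<in> V b; a \<in> {1..k}; b \<in> {1..k}\<rbrakk> \<Longrightarrow> a = b"
  using partite unfolding partite_tournament_def disjoint_family_on_def by blast

lemma no_arc_in_part: "\<lbrakk>u \<in> V a; v \<in> V a; a \<in> {1..k}\<rbrakk> \<Longrightarrow> (u, v) \<notin> parcs D"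
  using partite unfolding partite_tournament_def by blast

lemma arc_or_arc:
  assumes "u \<in> V a" "v \<in> pverts D - V a" "a \<in> {1..k}"
  shows "(u, v) \<in> parcs D \<or> (v, u) \<in> parcs D"
proof -
  obtain b where b: "b \<in> {1..k}" "v \<in> V b" using part_ex assms(2) by blast
  then have "a \<noteq> b" using assms(2) by blast
  have "\<forall>i\<in>{1..k}. \<forall>j\<in>{1..k}. i \<noteq> j \<longrightarrow>
      (\<forall>u\<in>V i. \<forall>v\<in>V j. (u, v) \<in> parcs D \<longleftrightarrow> (v, u) \<notin> parcs D)"
    using partite unfolding partite_tournament_def by (elim conjE)
  from this[rule_format, OF assms(3) b(1) \<open>a \<noteq> b\<close> assms(1) b(2)]
  show ?thesis by blast
qed

text \<open>Vertices of different partite sets are joined by some arc, and the order of the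
  components rules out the backward one.\<close>

lemma arc_if_less:
  assumes "u \<in> V a" "v \<in> verts (Q j) - V a" "a \<in> {1..k}" "u \<in> verts (Q i)" "i < j"
    "i \<in> {1..s}" "j \<in> {1..s}"
  shows "(u, v) \<in> parcs D"
proof -
  have "(v, u) \<notin> parcs D"
  proof
    assume "(v, u) \<in> parcs D"
    then obtain i' where "u \<in> verts (Q i')" "j \<le> i'" "i' \<in> {1..s}"
      using arc_le assms(2,7) by blast
    then show False using verts_Q_disjoint assms by fastforce
  qed
  moreover have "(u, v) \<in> parcs D \<or> (v, u) \<in> parcs D"
    using arc_or_arc[of u a v] assms verts_Q_subset[of j] by blast
  ultimately show ?thesis by blast
qed

lemma relpow_in_Q:
  assumes "u \<in> verts (Q i)" "v \<in> verts (Q i)" "i \<in> {1..s}"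
  shows "\<exists>n. (u, v) \<in> parcs D ^^ n"
proof -
  have "u \<rightarrow>\<^sup>*\<^bsub>with_proj D\<^esub> v"
    using verts_Q_in_sccs_verts[OF assms(3)] assms unfolding in_sccs_verts_conv_reachable by blast
  then have "(u, v) \<in> (parcs D)\<^sup>*"
    using reachable_rtranclI by force
  then show ?thesis by (simp add: rtrancl_power)
qed

lemma finite_verts_Q: "i \<in> {1..s} \<Longrightarrow> finite (verts (Q i))"
  using verts_Q_subset pair_finite_verts finite_subset by blast

end

section \<open>The last nontrivial component as a cyclic core\<close>

locale cyclic_last_component = ordered_partite_tournament +
  fixes t r :: nat and U :: "nat \<Rightarrow> 'a set"
  assumes k_ge_2: "k \<ge> 2"
    and last: "last_nontrivial_component s Q t"
    and index_4: "imprimitivity_index (Q t) = 4"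
    and t_less_s: "t < s"
    and imprim: "sets_of_imprimitivity (Q t) U"
    and V_Q_t: "\<forall>i\<in>{1, 2}. V i \<inter> verts (Q t) = U i \<union> U (i + 2)"
    and r_eq: "r = head_completing_index k V Q t"
begin

text \<open>Periodic extensions to all naturals; the shift by one translates the labels from 1 into
  residues from 0.\<close>

definition "C j = U (j mod 4 + 1)"
definition "P j = V (j mod 2 + 1)"
definition "H = (\<Union>i\<in>{1..r}. verts (Q i))"
definition "M = (\<Union>i\<in>{r<..<t}. verts (Q i))"
definition "Z = (\<Union>i\<in>{t<..s}. verts (Q i))"

lemma t_in: "t \<in> {1..s}"
  using last by (simp add: last_nontrivial_component_def)

lemma C_simps: "C 0 = U 1" "C 1 = U 2" "C 2 = U 3" "C 3 = U 4"
  by (simp_all add: C_def del: One_nat_def)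

lemma P_simps: "P 0 = V 1" "P 1 = V 2"
  by (simp_all add: P_def del: One_nat_def)

lemma P_index: "(j::nat) mod 2 + 1 \<in> {1..k}"
proof -
  have "j mod 2 < 2" by simp
  then show ?thesis unfolding atLeastAtMost_iff using k_ge_2 by linarith
qed

lemma C_index: "(j::nat) mod 4 + 1 \<in> {1..4}"
proof -
  have "j mod 4 < 4" by simp
  then show ?thesis unfolding atLeastAtMost_iff by linarith
qed

lemma verts_Q_t: "verts (Q t) = U 1 \<union> U 2 \<union> U 3 \<union> U 4"
proof -
  have "{1..4::nat} = {1, 2, 3, 4}" by auto
  then show ?thesis
    using imprim unfolding sets_of_imprimitivity_def Let_def index_4 by auto
qed

lemma UN_C: "(\<Union>j. C j) = verts (Q t)"
proof
  have "U i \<subseteq> verts (Q t)" if "i \<in> {1..4}" for i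
    using imprim that unfolding sets_of_imprimitivity_def Let_def index_4 by blast
  then show "(\<Union>j. C j) \<subseteq> verts (Q t)"
    unfolding C_def using C_index by blast
  show "verts (Q t) \<subseteq> (\<Union>j. C j)"
    unfolding verts_Q_t using C_simps by blast
qed

lemma C_unique: "u \<in> U i \<Longrightarrow> u \<in> U j \<Longrightarrow> i \<in> {1..4} \<Longrightarrow> j \<in> {1..4} \<Longrightarrow> i = j"
  using imprim unfolding sets_of_imprimitivity_def Let_def index_4 disjoint_family_on_def by blast

lemma C_nonempty: "C j \<noteq> {}"
  using imprim C_index unfolding sets_of_imprimitivity_def Let_def index_4 C_def by blast

lemma C_disjoint: "C j \<inter> C (j + 2) = {}"
proof -
  have "j mod 4 + 1 \<noteq> (j + 2) mod 4 + 1" by presburger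
  then show ?thesis unfolding C_def using C_unique C_index by blast
qed

lemma P_disjoint: "P j \<inter> P (Suc j) = {}"
proof -
  have "j mod 2 + 1 \<noteq> Suc j mod 2 + 1" by presburger
  then show ?thesis unfolding P_def using part_unique P_index by blast
qed

lemma C_subset_P: "C j \<subseteq> P j"
proof -
  have "C i \<subseteq> P i" if "i < 4" for i
  proof -
    have "i \<in> {0, 1, 2, 3}" using that by auto
    moreover have "U 1 \<union> U (1 + 2) \<subseteq> V 1" "U 2 \<union> U (2 + 2) \<subseteq> V 2"
      using V_Q_t by blast+
    ultimately show ?thesis
      by (auto simp: C_def P_def numeral_2_eq_2[symmetric] numeral_3_eq_3[symmetric])
  qed
  from this[of "j mod 4"] show ?thesis
    by (simp add: C_def P_def mod_mod_cancel)
qed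

lemma verts_Q_t_subset_P: "verts (Q t) \<subseteq> P 0 \<union> P 1"
proof -
  have "P i \<subseteq> P 0 \<union> P 1" for i
    by (cases "even i") (auto simp: P_def odd_iff_mod_2_eq_one)
  then show ?thesis using UN_C C_subset_P by blast
qed

text \<open>\<open>Q t\<close> meets \<open>V 1\<close> and \<open>V 2\<close> and no other partite
  set. So the set behind the head completing index consists of those \<open>i\<close> with
  \<open>1 \<le> i < t\<close> whose component is not contained in \<open>V 1 \<union> V 2\<close>,
  and \<open>r\<close> is its maximum or 0.\<close>

lemma r_less_t: "r < t"
  and head_exceptional: "r \<ge> 1 \<Longrightarrow> \<exists>x\<in>verts (Q r). x \<notin> V 1 \<union> V 2"
  and after_head: "r < i \<Longrightarrow> i < t \<Longrightarrow> verts (Q i) \<subseteq> V 1 \<union> V 2"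
proof -
  let ?R = "{r. 1 \<le> r \<and> r < t \<and> (\<exists>X\<in>partite_sets_of k V (Q r).
    \<forall>Y\<in>partite_sets_of k V (Q t). \<not> partite_related k V X Y)}"
  have R_iff: "i \<in> ?R \<longleftrightarrow> 1 \<le> i \<and> i < t \<and> \<not> verts (Q i) \<subseteq> V 1 \<union> V 2" for i
  proof (cases "1 \<le> i \<and> i < t")
    case True
    then have i: "i \<in> {1..s}" using t_less_s by auto
    have Vt: "verts (Q t) \<inter> V 1 \<noteq> {}" "verts (Q t) \<inter> V 2 \<noteq> {}" "verts (Q t) \<subseteq> V 1 \<union> V 2"
      using UN_C C_subset_P[of 0] C_subset_P[of 1] C_nonempty[of 0] C_nonempty[of 1] verts_Q_t_subset_P
      unfolding P_simps by blast+
    have V12: "1 \<in> {1..k}" "2 \<in> {1..k}" using k_ge_2 by auto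
    have "(\<exists>X\<in>partite_sets_of k V (Q i).
        \<forall>Y\<in>partite_sets_of k V (Q t). \<not> partite_related k V X Y) \<longleftrightarrow> \<not> verts (Q i) \<subseteq> V 1 \<union> V 2"
    proof
      assume "\<exists>X\<in>partite_sets_of k V (Q i). \<forall>Y\<in>partite_sets_of k V (Q t). \<not> partite_related k V X Y"
      then obtain a where a: "a \<in> {1..k}" "verts (Q i) \<inter> V a \<noteq> {}"
        "\<forall>Y\<in>partite_sets_of k V (Q t). \<not> partite_related k V (verts (Q i) \<inter> V a) Y"
        unfolding partite_sets_of_def by blast
      have "a \<noteq> b" if "b \<in> {1, 2}" for b
      proof
        assume "a = b"
        then have "verts (Q t) \<inter> V a \<in> partite_sets_of k V (Q t)"
          using that Vt(1,2) a(1) unfolding partite_sets_of_def by blast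
        then show False using a unfolding partite_related_def by blast
      qed
      then have "a \<noteq> 1" "a \<noteq> 2" by auto
      then show "\<not> verts (Q i) \<subseteq> V 1 \<union> V 2"
        using a part_unique V12 by blast
    next
      assume "\<not> verts (Q i) \<subseteq> V 1 \<union> V 2"
      then obtain x where x: "x \<in> verts (Q i)" "x \<notin> V 1 \<union> V 2" by blast
      then obtain a where a: "a \<in> {1..k}" "x \<in> V a" using part_ex verts_Q_subset i by blast
      have "\<not> partite_related k V (verts (Q i) \<inter> V a) Y" if "Y \<in> partite_sets_of k V (Q t)" for Y
      proof
        assume "partite_related k V (verts (Q i) \<inter> V a) Y"
        then have "Y \<subseteq> V a" using x a part_unique unfolding partite_related_def by blast
        moreover have "Y \<inter> (V 1 \<union> V 2) \<noteq> {}" using that Vt unfolding partite_sets_of_def by blast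
        ultimately show False using part_unique V12 a x by blast
      qed
      then show "\<exists>X\<in>partite_sets_of k V (Q i). \<forall>Y\<in>partite_sets_of k V (Q t). \<not> partite_related k V X Y"
        using x a unfolding partite_sets_of_def by blast
    qed
    then show ?thesis using True by simp
  next
    case False
    then show ?thesis by auto
  qed
  have finite: "finite ?R" by (rule finite_subset[of _ "{..<t}"]) auto
  have r: "r = (if ?R = {} then 0 else Max ?R)"
    unfolding r_eq head_completing_index_def Let_def ..
  show "r < t"
    using r Max_in[OF finite] t_in by (cases "?R = {}") auto
  show "\<exists>x\<in>verts (Q r). x \<notin> V 1 \<union> V 2" if "r \<ge> 1"
  proof -
    have ne: "?R \<noteq> {}"
    proof
      assume "?R = {}"
      then have "r = 0" using r by (simp only: simp_thms if_True)
      then show False using that by simp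
    qed
    then have "r = Max ?R" using r by (simp only: if_False)
    then have "r \<in> ?R" using Max_in[OF finite ne] by (simp only:)
    then show ?thesis using R_iff[of r] by blast
  qed
  show "verts (Q i) \<subseteq> V 1 \<union> V 2" if "r < i" "i < t"
  proof (rule ccontr)
    assume "\<not> ?thesis"
    then have i: "i \<in> ?R" using R_iff[of i] that by linarith
    then have "?R \<noteq> {}" by blast
    then have "r = Max ?R" using r by (simp only: if_False)
    then have "i \<le> r" using Max_ge[OF finite i] by (simp only:)
    then show False using that by simp
  qed
qed

lemma pverts_eq: "pverts D = H \<union> M \<union> (\<Union>j. C j) \<union> Z"
proof -
  have "{1..s} = {1..r} \<union> {r<..<t} \<union> {t} \<union> {t<..s}"
    using r_less_t t_less_s by auto
  then show ?thesis
    unfolding H_def M_def Z_def UN_C UN_verts_Q[symmetric] by blast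
qed

lemma Z_disjoint: "Z \<inter> (H \<union> M \<union> (\<Union>j. C j)) = {}"
proof -
  have "i \<in> {1..t} \<Longrightarrow> j \<in> {t<..s} \<Longrightarrow> verts (Q i) \<inter> verts (Q j) = {}" for i j
    using verts_Q_disjoint[of _ i j] by fastforce
  moreover have "{1..r} \<union> {r<..<t} \<union> {t} \<subseteq> {1..t}" using r_less_t by auto
  ultimately show ?thesis unfolding H_def M_def Z_def UN_C by blast
qed

text \<open>The head lies in \<open>Q t\<close> or in a later component. In the first case the
  imprimitivity condition moves it to the next set.\<close>

lemma arc_C_cases:
  assumes "(u, v) \<in> parcs D" "u \<in> C j"
  shows "v \<in> C (Suc j) \<union> Z"
proof -
  have u: "u \<in> verts (Q t)" using assms(2) UN_C by blast
  obtain i where i: "v \<in> verts (Q i)" "t \<le> i" "i \<in> {1..s}"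
    using arc_le[OF assms(1) u t_in] .
  show ?thesis
  proof (cases "i = t")
    case True
    have "(u, v) \<in> arcs (Q t)" "tail (Q t) (u, v) = u" "head (Q t) (u, v) = v"
      using arc_in_Q[OF assms(1) u _ t_in] i True by auto
    then obtain l where l: "l \<in> {1..4}" "u \<in> U l" "v \<in> U (l mod 4 + 1)"
      using imprim unfolding sets_of_imprimitivity_def Let_def index_4 by force
    then have "l = j mod 4 + 1" using C_unique C_index assms(2) unfolding C_def by blast
    moreover have "(j mod 4 + 1) mod 4 = Suc j mod 4" by (simp add: mod_Suc_eq)
    ultimately show ?thesis using l unfolding C_def by simp
  next
    case False
    then show ?thesis using i unfolding Z_def by auto
  qed
qed

sublocale core: cyclic_core "parcs D" H M Z C P
proof
  show "finite H"
    unfolding H_def using finite_verts_Q r_less_t t_less_s by auto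
  show "C (j + 4) = C j" for j
    by (simp add: C_def)
  show "P (j + 2) = P j" for j
    by (simp add: P_def)
  show "P j \<inter> P (Suc j) = {}" for j
    by (fact P_disjoint)
  show "C j \<inter> C (j + 2) = {}" for j
    by (fact C_disjoint)
  show "C j \<noteq> {}" for j
    by (fact C_nonempty)
  show C_P: "C j \<subseteq> P j" for j
    by (fact C_subset_P)
  show "M \<subseteq> P 0 \<union> P 1"
    unfolding M_def P_simps by (intro UN_least after_head) simp_all
  show "parcs D `` {u} = C (Suc j) \<union> (Z - P j)" if u: "u \<in> C j" for u j
  proof
    show "parcs D `` {u} \<subseteq> C (Suc j) \<union> (Z - P j)"
      using arc_C_cases[OF _ u] no_arc_in_part[OF _ _ P_index] C_P[of j] u unfolding P_def by blast
    show "C (Suc j) \<union> (Z - P j) \<subseteq> parcs D `` {u}"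
    proof
      fix v assume "v \<in> C (Suc j) \<union> (Z - P j)"
      then consider "v \<in> C (Suc j)" | i where "v \<in> verts (Q i) - P j" "t < i" "i \<le> s"
        unfolding Z_def by auto
      then show "v \<in> parcs D `` {u}"
      proof cases
        case 1
        \<comment> \<open>The reverse arc would put \<open>u\<close> into \<open>C (j + 2)\<close>
          or \<open>Z\<close>. As \<open>u\<close> and \<open>v\<close> lie in different partite
          sets, the arc goes forward: consecutive sets are completely joined.\<close>
        have "(v, u) \<notin> parcs D"
        proof
          assume "(v, u) \<in> parcs D"
          then have "u \<in> C (Suc (Suc j)) \<union> Z" using arc_C_cases 1 by blast
          then show False using u C_disjoint[of j] Z_disjoint by auto
        qed
        moreover have "v \<in> pverts D - P j"
          using 1 C_P[of "Suc j"] P_disjoint[of j] pverts_eq by blast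
        ultimately show ?thesis
          using arc_or_arc[of u "j mod 2 + 1" v] P_index C_P[of j] u unfolding P_def by blast
      next
        case (2 i)
        have "u \<in> verts (Q t)" "u \<in> P j" using u UN_C C_P[of j] by blast+
        then have "(u, v) \<in> parcs D"
          using arc_if_less[of u "j mod 2 + 1" v i t] P_index[of j] t_in 2 unfolding P_def by simp
        then show ?thesis by blast
      qed
    qed
  qed
  show "C (Suc j) \<union> C (j + 3) \<subseteq> parcs D `` {u}" if u: "u \<in> M" "u \<in> P j" for u j
  proof
    fix v assume "v \<in> C (Suc j) \<union> C (j + 3)"
    moreover have "P (j + 3) = P (Suc j)" unfolding P_def by (rule arg_cong[where f = V]) presburger
    ultimately have v: "v \<in> verts (Q t) - P j"
      using C_P P_disjoint[of j] UN_C by blast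
    obtain i where "u \<in> verts (Q i)" "r < i" "i < t" using u(1) unfolding M_def by auto
    then show "v \<in> parcs D `` {u}"
      using arc_if_less[of u "j mod 2 + 1" v t i] P_index u v t_in unfolding P_def by auto
  qed
  show "parcs D `` {u} \<subseteq> M \<union> (\<Union>i. C i) \<union> Z - P j" if u: "u \<in> M" "u \<in> P j" for u j
  proof
    fix v assume "v \<in> parcs D `` {u}"
    then have uv: "(u, v) \<in> parcs D" by simp
    obtain i where i: "u \<in> verts (Q i)" "r < i" "i < t" using u(1) unfolding M_def by auto
    then have "i \<in> {1..s}" using t_in by auto
    then obtain l where "v \<in> verts (Q l)" "i \<le> l" "l \<in> {1..s}" using arc_le[OF uv i(1)] by blast
    then have "v \<in> M \<union> (\<Union>i. C i) \<union> Z"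
      using i unfolding UN_C M_def Z_def by (cases l t rule: linorder_cases) auto
    moreover have "v \<notin> P j" using no_arc_in_part[OF _ _ P_index] u(2) uv unfolding P_def by blast
    ultimately show "v \<in> M \<union> (\<Union>i. C i) \<union> Z - P j" by blast
  qed
  show "\<exists>n x. (u, x) \<in> parcs D ^^ n \<and> (\<Union>i. C i) \<subseteq> parcs D `` {x}" if u: "u \<in> H" for u
  proof -
    obtain i where i: "u \<in> verts (Q i)" "1 \<le> i" "i \<le> r" using u unfolding H_def by auto
    have i_s: "i \<in> {1..s}" and rs: "r \<in> {1..s}" using i r_less_t t_less_s by auto
    \<comment> \<open>Such an \<open>x\<close> differs in partite set from every vertex of
      \<open>Q t\<close> and precedes them all.\<close>
    have all: "(\<Union>i. C i) \<subseteq> parcs D `` {x}" if x: "x \<in> verts (Q l)" "x \<notin> V 1 \<union> V 2" "l \<in> {1..r}" for x l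
    proof
      fix v assume v: "v \<in> (\<Union>i. C i)"
      have ls: "l \<in> {1..s}" "l < t" using x(3) r_less_t t_less_s by auto
      obtain a where a: "a \<in> {1..k}" "x \<in> V a" using part_ex verts_Q_subset[OF ls(1)] x(1) by blast
      have "v \<in> V 1 \<union> V 2" using v UN_C verts_Q_t_subset_P unfolding P_simps by blast
      then have "v \<notin> V a" using part_unique[of v a] a x(2) k_ge_2
        by (metis P_index P_simps P_def UnE UnI1 UnI2)
      then show "v \<in> parcs D `` {x}"
        using arc_if_less[of x a v t l] v a x(1) ls t_in UN_C by auto
    qed
    obtain x where x: "x \<in> verts (Q r)" "x \<notin> V 1 \<union> V 2" using head_exceptional i by auto
    have "r \<in> {1..r}" using i by auto
    note x_all = all[OF x this]
    show ?thesis
    \<comment> \<open>Either \<open>u\<close> itself dominates the core, or it reaches the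
      exceptional \<open>x\<close> in \<open>Q r\<close>: by a walk inside \<open>Q r\<close> if it
      lies there, otherwise by a single arc, since their partite sets differ.\<close>
    proof (cases "u \<in> V 1 \<union> V 2")
      case False
      then have "(u, u) \<in> parcs D ^^ 0 \<and> (\<Union>i. C i) \<subseteq> parcs D `` {u}" using all i by auto
      then show ?thesis by blast
    next
      case True
      show ?thesis
      proof (cases "i = r")
        case True
        then show ?thesis using relpow_in_Q[OF i(1), of x] i_s x(1) x_all by blast
      next
        case False
        obtain a where a: "u \<in> V a" "x \<notin> V a" "a \<in> {1..k}" using True x(2) k_ge_2
          by (metis P_index P_simps P_def UnE UnI1 UnI2)
        then have "(u, x) \<in> parcs D" using arc_if_less[of u a x r i] i i_s rs x(1) False by auto
        then have "(u, x) \<in> parcs D ^^ 1" by simp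
        then show ?thesis using x_all by blast
      qed
    qed
  qed
  \<comment> \<open>Components after \<open>Q t\<close> are single vertices without loops, so every
    arc leads to a strictly later component.\<close>
  have Z_step: "\<exists>l. v \<in> verts (Q l) \<and> i < l \<and> l \<le> s"
    if uv: "(u, v) \<in> parcs D" "u \<in> verts (Q i)" "t < i" "i \<le> s" for u v i
  proof -
    have "i \<in> {1..s}" using that by auto
    then obtain l where l: "v \<in> verts (Q l)" "i \<le> l" "l \<in> {1..s}" using arc_le[OF uv(1,2)] by blast
    have "l \<noteq> i"
    proof
      assume "l = i"
      moreover have "card (verts (Q i)) = 1"
        using last uv unfolding last_nontrivial_component_def trivial_component_def by auto
      ultimately have "u = v" using uv l by (metis card_1_singletonE singletonD)
      then show False using pair_no_loops[OF uv(1)] by simp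
    qed
    then show ?thesis using l by (intro exI[of _ l]) auto
  qed
  show "parcs D `` Z \<subseteq> Z"
    unfolding Z_def using Z_step by fastforce
  show "parcs D `` {u} \<inter> P j = {}" if "u \<in> Z" "u \<in> P j" for u j
    using no_arc_in_part[OF _ _ P_index] that(2) unfolding P_def by blast
  \<comment> \<open>Each step raises the component index, so \<open>s\<close> steps from
    \<open>Z\<close> would overshoot \<open>s\<close>.\<close>
  have "\<exists>l. v \<in> verts (Q l) \<and> t + n < l \<and> l \<le> s" if "(u, v) \<in> parcs D ^^ n" "u \<in> Z" for u v n
    using that
  proof (induction n arbitrary: v)
    case 0
    then show ?case unfolding Z_def by auto
  next
    case (Suc n)
    then obtain w where w: "(u, w) \<in> parcs D ^^ n" "(w, v) \<in> parcs D" by auto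
    then obtain l where l: "w \<in> verts (Q l)" "t + n < l" "l \<le> s" using Suc by blast
    then obtain l' where "v \<in> verts (Q l')" "l < l'" "l' \<le> s" using Z_step[OF w(2) l(1)] by auto
    then show ?case using l by (intro exI[of _ l']) auto
  qed
  from this[of _ _ s] show "\<exists>n. (parcs D ^^ n) `` Z = {}"
    by (intro exI[of _ s]) fastforce
qed

end

section \<open>Identification of the competition graphs\<close>

lemma arcs_join_complete_on:
  assumes "A \<inter> (B \<union> C) = {}"
  shows "(u, v) \<in> arcs (join (complete_on A) (union (complete_on B) (complete_on C))) \<longleftrightarrow> u \<noteq> v \<and>
    (u \<in> A \<and> v \<in> A \<or> u \<in> B \<and> v \<in> B \<or> u \<in> C \<and> v \<in> C \<or>
     u \<in> A \<and> v \<in> B \<union> C \<or> u \<in> B \<union> C \<and> v \<in> A)"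
  \<comment> \<open>\<open>join\<close> does not ask its cross edges to have distinct ends; the
    disjointness assumption supplies this.\<close>
  using assms by (simp add: complete_on_def join_def) blast

text \<open>All isomorphisms of the theorem come from equality of graphs, through the identity
  map.\<close>

lemma digraph_iso_m_step_competition_graphI:
  assumes "wf_digraph G" "m_step_competition_graph m G = H"
  shows "digraph_iso (m_step_competition_graph m G) H"
proof -
  have "wf_digraph (m_step_competition_graph m G)"
    by unfold_locales (auto simp: m_step_competition_graph_def)
  then show ?thesis
    using digraph_iso_refl assms(2) by blast
qed

context cyclic_last_component
begin

definition "X = H \<union> M \<union> (\<Union>j. C j)"

text \<open>For large \<open>m\<close> no walk of length \<open>m\<close> starts in
  \<open>Z\<close>, so its vertices are isolated.\<close>

lemma eventually_m_step_competition_graph: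
  "eventually (\<lambda>m. m_step_competition_graph m (with_proj D) = with_proj
     \<lparr> pverts = X \<union> Z, parcs = {(u, v). u \<in> X \<and> v \<in> X \<and> u \<noteq> v \<and> core.adj m u v} \<rparr>) sequentially"
  using core.eventually_not_adj_Z
proof eventually_elim
  case (elim m)
  have "{(u, v). u \<in> pverts D \<and> v \<in> pverts D \<and> u \<noteq> v \<and>
      (parcs D ^^ m) `` {u} \<inter> (parcs D ^^ m) `` {v} \<noteq> {}} =
    {(u, v). u \<in> X \<and> v \<in> X \<and> u \<noteq> v \<and> core.adj m u v}"
    using elim unfolding X_def pverts_eq core.adj_def core.R_def by blast
  then show ?case
    using m_step_competition_graph_with_proj[OF wf_digraph_axioms, of m] pverts_eq X_def by simp
qed

lemma eventually_digraph_iso_unionI: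
  assumes "eventually (\<lambda>m. verts (G m) = X \<and> tail (G m) = fst \<and> head (G m) = snd \<and>
    arcs (G m) = {(u, v). u \<in> X \<and> v \<in> X \<and> u \<noteq> v \<and> core.adj m u v}) sequentially"
  shows "eventually (\<lambda>m. digraph_iso (m_step_competition_graph m (with_proj D))
    (union (G m) (edgeless_on Z))) sequentially"
  using assms eventually_m_step_competition_graph
proof eventually_elim
  case (elim m)
  show ?case
    by (rule digraph_iso_m_step_competition_graphI[OF wf_digraph_axioms])
      (use elim in \<open>simp add: union_def edgeless_on_def with_proj_def\<close>)
qed

lemma eventually_iso_complete:
  assumes "\<not> Z \<subseteq> P 0 \<union> P 1"
  shows "eventually (\<lambda>m. digraph_iso (m_step_competition_graph m (with_proj D))
    (union (complete_on X) (edgeless_on Z))) sequentially"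
proof (rule eventually_digraph_iso_unionI)
  show "eventually (\<lambda>m. verts (complete_on X) = X \<and> tail (complete_on X) = fst \<and>
      head (complete_on X) = snd \<and>
      arcs (complete_on X) = {(u, v). u \<in> X \<and> v \<in> X \<and> u \<noteq> v \<and> core.adj m u v}) sequentially"
    using core.eventually_adj_complete[OF assms]
    by eventually_elim (auto simp: complete_on_def X_def)
qed

text \<open>\<open>Z\<close> meets both partite sets, so the condition
  \<open>Z \<inter> P (j + m) \<noteq> {}\<close> always holds and the parity of \<open>m\<close>
  disappears.\<close>

lemma eventually_iso_join:
  assumes "Z \<subseteq> P 0 \<union> P 1" "Z \<inter> P 0 \<noteq> {}" "Z \<inter> P 1 \<noteq> {}"
  shows "eventually (\<lambda>m. digraph_iso (m_step_competition_graph m (with_proj D))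
    (union (join (complete_on H) (union (complete_on (P 0 \<inter> (M \<union> (\<Union>j. C j))))
      (complete_on (P 1 \<inter> (M \<union> (\<Union>j. C j)))))) (edgeless_on Z))) sequentially"
proof (rule eventually_digraph_iso_unionI)
  let ?A = "\<lambda>i. P i \<inter> (M \<union> (\<Union>j. C j))"
  let ?G = "join (complete_on H) (union (complete_on (?A 0)) (complete_on (?A 1)))"
  have MC: "M \<union> (\<Union>j. C j) \<subseteq> P 0 \<union> P 1"
    unfolding core.M_Un_UN_C using core.C_subset_P_0_1 by blast
  have ZP: "Z \<inter> P i \<noteq> {}" for i
  proof (cases "even i")
    case True
    then have "P i = P 0" by (intro core.P_cong) simp
    then show ?thesis using assms(2) by simp
  next
    case False
    then have "P i = P 1" by (intro core.P_cong) presburger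
    then show ?thesis using assms(3) by simp
  qed
  have HM: "H \<inter> (M \<union> (\<Union>j. C j)) = {}"
  proof -
    have "verts (Q i) \<inter> verts (Q j) = {}" if "i \<in> {1..r}" "j \<in> {r<..<t} \<union> {t}" for i j
    proof -
      have "i \<noteq> j" "i \<in> {1..s}" "j \<in> {1..s}" using that r_less_t t_less_s by auto
      then show ?thesis using verts_Q_disjoint by blast
    qed
    then show ?thesis unfolding H_def M_def UN_C by blast
  qed
  show "eventually (\<lambda>m. verts ?G = X \<and> tail ?G = fst \<and> head ?G = snd \<and>
      arcs ?G = {(u, v). u \<in> X \<and> v \<in> X \<and> u \<noteq> v \<and> core.adj m u v}) sequentially"
    using core.eventually_adj_iff[OF assms(1)]
  proof eventually_elim
    case (elim m)
    have vG: "verts ?G = X"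
      using MC by (auto simp: complete_on_def join_def X_def)
    have "(u, v) \<in> arcs ?G \<longleftrightarrow> u \<in> X \<and> v \<in> X \<and> u \<noteq> v \<and> core.adj m u v" for u v
    proof -
      have "(u, v) \<in> arcs ?G \<longleftrightarrow> u \<noteq> v \<and>
        (u \<in> H \<and> v \<in> H \<or> u \<in> ?A 0 \<and> v \<in> ?A 0 \<or> u \<in> ?A 1 \<and> v \<in> ?A 1 \<or>
         u \<in> H \<and> v \<in> ?A 0 \<union> ?A 1 \<or> u \<in> ?A 0 \<union> ?A 1 \<and> v \<in> H)"
        by (rule arcs_join_complete_on) (use HM in blast)
      also have "?A 0 \<union> ?A 1 = M \<union> (\<Union>j. C j)"
        using MC by blast
      also have "(u \<noteq> v \<and> (u \<in> H \<and> v \<in> H \<or> u \<in> ?A 0 \<and> v \<in> ?A 0 \<or> u \<in> ?A 1 \<and> v \<in> ?A 1 \<or>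
         u \<in> H \<and> v \<in> M \<union> (\<Union>j. C j) \<or> u \<in> M \<union> (\<Union>j. C j) \<and> v \<in> H)) \<longleftrightarrow>
        u \<in> X \<and> v \<in> X \<and> u \<noteq> v \<and> (u \<in> H \<or> v \<in> H \<or> (\<exists>j\<in>{0, 1}. u \<in> P j \<and> v \<in> P j))"
        using MC unfolding X_def Un_assoc Int_iff Un_iff[of _ H] bex_simps by blast
      also have "\<dots> \<longleftrightarrow> u \<in> X \<and> v \<in> X \<and> u \<noteq> v \<and> core.adj m u v"
        using elim[folded X_def, rule_format, of u v] ZP by auto
      finally show ?thesis .
    qed
    then have "arcs ?G = {(u, v). u \<in> X \<and> v \<in> X \<and> u \<noteq> v \<and> core.adj m u v}"
      by auto
    then show ?case
      using vG by (simp add: join_def)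
  qed
qed

lemma eventually_iso_blowup:
  assumes "Z \<subseteq> P l" "l \<in> {0, 1}" "Z \<noteq> {}"
  shows "eventually (\<lambda>m. digraph_iso (m_step_competition_graph m (with_proj D))
    (union (clique_blowup 7 core.block (if even (l + m) then core.G4_pairs else core.G5_pairs))
      (edgeless_on Z))) sequentially"
proof (rule eventually_digraph_iso_unionI)
  let ?G = "\<lambda>m. clique_blowup 7 core.block (if even (l + m) then core.G4_pairs else core.G5_pairs)"
  have "Z \<subseteq> P 0 \<union> P 1" using assms by blast
  from core.eventually_adj_iff[OF this]
  show "eventually (\<lambda>m. verts (?G m) = X \<and> tail (?G m) = fst \<and> head (?G m) = snd \<and>
      arcs (?G m) = {(u, v). u \<in> X \<and> v \<in> X \<and> u \<noteq> v \<and> core.adj m u v}) sequentially"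
  proof eventually_elim
    case (elim m)
    \<comment> \<open>\<open>Z\<close> meets \<open>P (j + m)\<close> exactly if
      \<open>j + m\<close> and \<open>l\<close> have the same parity, that is, if \<open>j\<close>
      has the parity of \<open>l + m\<close>.\<close>
    define e where "e = (l + m) mod 2"
    have e: "e \<in> {0, 1}" "even (l + m) \<longleftrightarrow> e = 0"
      unfolding e_def by auto
    have ZP: "Z \<inter> P (j + m) \<noteq> {} \<longleftrightarrow> j = e" if "j \<in> {0, 1}" for j
    proof (cases "j = e")
      case True
      then have "P (j + m) = P l"
        unfolding e_def by (intro core.P_cong) presburger
      then show ?thesis using True assms by auto
    next
      case False
      then have "(j + m) mod 2 = Suc l mod 2"
        using that e(1) unfolding e_def by auto presburger+
      then have "P (j + m) = P (Suc l)"
        by (rule core.P_cong)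
      then show ?thesis using False assms(1) P_disjoint[of l] by auto
    qed
    have "arcs (?G m) = {(u, v). u \<noteq> v \<and> (\<exists>a\<in>{1..7}. \<exists>b\<in>{1..7}. u \<in> core.block a \<and> v \<in> core.block b \<and>
      (a = b \<or> {a, b} \<in> (if e = 0 then core.G4_pairs else core.G5_pairs)))}"
      unfolding clique_blowup_def e(2) by (simp only: with_proj_simps pair_pre_digraph.simps)
    also have "\<dots> = {(u, v). u \<in> X \<and> v \<in> X \<and> u \<noteq> v \<and> core.adj m u v}"
      unfolding core.block_pairs[OF e(1)] X_def[symmetric] using elim[folded X_def] ZP by auto
    finally show ?case
      using core.UN_block X_def by (simp only: clique_blowup_def with_proj_simps pair_pre_digraph.simps simp_thms)
  qed
qed

end

section \<open>Assembly of the four cases\<close>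

theorem theorem2p8:
  fixes D :: "'a pair_pre_digraph"
    and V U :: "nat \<Rightarrow> 'a set"
    and Q :: "nat \<Rightarrow> ('a, 'a \<times> 'a) pre_digraph"
    and k s t r :: nat
    and A1 A2 Z :: "'a set"
  assumes "k \<ge> 2" and "s \<ge> 2"
    and "partite_tournament D k V"
    and "ordered_strong_components (with_proj D) s Q"
    and "last_nontrivial_component s Q t"
    and "imprimitivity_index (Q t) = 4"
    and "t < s"
    and "sets_of_imprimitivity (Q t) U"
    and "\<forall>i\<in>{1, 2}. V i \<inter> verts (Q t) = U i \<union> U (i + 2)"
    and "r = head_completing_index k V Q t"
    and "A1 = V 1 \<inter> (\<Union>i\<in>{r+1..t}. verts (Q i))"
    and "A2 = V 2 \<inter> (\<Union>i\<in>{r+1..t}. verts (Q i))"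
    and "Z = verts (component_range (with_proj D) Q (t+1) s)"
  shows "\<exists>N>0. \<forall>m\<ge>N.
    (\<not> Z \<subseteq> V 1 \<union> V 2 \<longrightarrow>
       digraph_iso (m_step_competition_graph m (with_proj D))
         (union (complete_on (verts (component_range (with_proj D) Q 1 t))) (edgeless_on Z))) \<and>
    (Z \<subseteq> V 1 \<union> V 2 \<and> Z \<inter> V 1 \<noteq> {} \<and> Z \<inter> V 2 \<noteq> {} \<longrightarrow>
       digraph_iso (m_step_competition_graph m (with_proj D))
         (union
           (join (complete_on (verts (component_range (with_proj D) Q 1 r)))
                 (union (complete_on A1) (complete_on A2)))
           (edgeless_on Z))) \<and>
    (Z \<subseteq> V 1 \<longrightarrow>
       digraph_iso (m_step_competition_graph m (with_proj D))
         (union (if even m then G4 Q U r t A1 A2 else G5 Q U r t A1 A2) (edgeless_on Z))) \<and>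
    (Z \<subseteq> V 2 \<longrightarrow>
       digraph_iso (m_step_competition_graph m (with_proj D))
         (union (if even m then G5 Q U r t A1 A2 else G4 Q U r t A1 A2) (edgeless_on Z)))"
    (is "\<exists>N>0. \<forall>m\<ge>N. ?claim m")
proof -
  interpret L: cyclic_last_component D k V s Q t r U
    by unfold_locales (use assms in auto)
  have range_verts: "verts (component_range (with_proj D) Q a b) = (\<Union>i\<in>{a..b}. verts (Q i))" for a b
    by (simp add: component_range_def)
  have "{t + 1..s} = {t<..s}" by auto
  then have Z: "Z = L.Z"
    unfolding assms(13) range_verts L.Z_def by simp
  have H: "verts (component_range (with_proj D) Q 1 r) = L.H"
    unfolding range_verts L.H_def ..
  have "{1..t} = {1..r} \<union> {r<..<t} \<union> {t}"
    using L.r_less_t by auto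
  note head_range = this
  have X: "verts (component_range (with_proj D) Q 1 t) = L.X"
    unfolding range_verts L.X_def L.H_def L.M_def L.UN_C head_range by blast
  have tail_range: "{r + 1..t} = {r<..<t} \<union> {t}"
    using L.r_less_t by auto
  have A: "A1 = L.P 0 \<inter> (L.M \<union> (\<Union>j. L.C j))" "A2 = L.P 1 \<inter> (L.M \<union> (\<Union>j. L.C j))"
    unfolding assms(11,12) tail_range L.M_def L.UN_C L.P_simps by auto
  have "verts (Q t) \<inter> L.M = {}"
  proof -
    have "verts (Q t) \<inter> verts (Q i) = {}" if "i \<in> {r<..<t}" for i
      using L.verts_Q_disjoint[of _ t i] L.t_in that by fastforce
    then show ?thesis unfolding L.M_def by blast
  qed
  then have "A1 - verts (Q t) = L.M \<inter> L.P 0" "A2 - verts (Q t) = L.M \<inter> L.P 1"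
    unfolding A L.UN_C by blast+
  then have "blocks Q U r t A1 A2 = L.core.block"
    by (intro ext) (simp only: blocks_def L.core.block_def L.C_simps flip: L.H_def)
  then have G: "G4 Q U r t A1 A2 = clique_blowup 7 L.core.block L.core.G4_pairs"
    "G5 Q U r t A1 A2 = clique_blowup 7 L.core.block L.core.G5_pairs"
    by (simp_all only: G4_def G5_def)
  \<comment> \<open>Since \<open>t < s\<close>, the component \<open>Q s\<close> lies in
    \<open>Z\<close>. Nonemptiness of \<open>Z\<close> keeps the cases
    \<open>Z \<subseteq> V 1\<close> and \<open>Z \<subseteq> V 2\<close> from overlapping.\<close>
  have "verts (Q s) \<noteq> {}"
    using L.verts_Q_in_sccs_verts[of s] assms(2) unfolding L.in_sccs_verts_conv_reachable by auto
  then have Z_ne: "L.Z \<noteq> {}"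
    using assms(7) unfolding L.Z_def by auto
  have "eventually (\<lambda>m. \<not> Z \<subseteq> V 1 \<union> V 2 \<longrightarrow>
       digraph_iso (m_step_competition_graph m (with_proj D))
         (union (complete_on (verts (component_range (with_proj D) Q 1 t))) (edgeless_on Z))) sequentially"
    using L.eventually_iso_complete unfolding X Z L.P_simps
    by (cases "L.Z \<subseteq> V 1 \<union> V 2") simp_all
  moreover have "eventually (\<lambda>m. Z \<subseteq> V 1 \<union> V 2 \<and> Z \<inter> V 1 \<noteq> {} \<and> Z \<inter> V 2 \<noteq> {} \<longrightarrow>
       digraph_iso (m_step_competition_graph m (with_proj D))
         (union
           (join (complete_on (verts (component_range (with_proj D) Q 1 r)))
                 (union (complete_on A1) (complete_on A2)))
           (edgeless_on Z))) sequentially"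
    using L.eventually_iso_join unfolding A H Z L.P_simps
    by (cases "L.Z \<subseteq> V 1 \<union> V 2 \<and> L.Z \<inter> V 1 \<noteq> {} \<and> L.Z \<inter> V 2 \<noteq> {}") simp_all
  moreover have "eventually (\<lambda>m. Z \<subseteq> V 1 \<longrightarrow>
       digraph_iso (m_step_competition_graph m (with_proj D))
         (union (if even m then G4 Q U r t A1 A2 else G5 Q U r t A1 A2) (edgeless_on Z))) sequentially"
  proof (cases "Z \<subseteq> V 1")
    case True
    then show ?thesis
      using L.eventually_iso_blowup[of 0] Z_ne unfolding G Z L.P_simps add_0
      by (auto elim!: eventually_mono simp: if_distrib[of "clique_blowup 7 L.core.block"] simp del: One_nat_def)
  qed simp
  \<comment> \<open>Here \<open>l = 1\<close>, so the parity of \<open>l + m\<close> is opposite to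
    that of \<open>m\<close> and the two graphs trade places.\<close>
  moreover have "eventually (\<lambda>m. Z \<subseteq> V 2 \<longrightarrow>
       digraph_iso (m_step_competition_graph m (with_proj D))
         (union (if even m then G5 Q U r t A1 A2 else G4 Q U r t A1 A2) (edgeless_on Z))) sequentially"
  proof (cases "Z \<subseteq> V 2")
    case True
    then show ?thesis
      using L.eventually_iso_blowup[of 1] Z_ne unfolding G Z L.P_simps
      by (auto elim!: eventually_mono simp: if_distrib[of "clique_blowup 7 L.core.block"] simp del: One_nat_def)
  qed simp
  ultimately have "eventually ?claim sequentially"
    by eventually_elim (intro conjI)
  then obtain N where "\<forall>m\<ge>N. ?claim m"
    unfolding eventually_sequentially by blast
  then show ?thesis
    \<comment> \<open>The successor makes the bound positive.\<close>
    by (intro exI[of _ "Suc N"]) simp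
qed

end
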